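(* Let $\xi$ be a symmetric canonical element of $Sp(n)$ and suppose that $N_\xi=\iota(G^{\mathbb H}_m(n))$ with $2m\le n$. Then, for $1\le k\le n$, $$r_{\rho_k}(\xi)\le 4mk\quad\text{if } k\le n-2m+1,$$ and $$r_{\rho_k}(\xi)\le 4m(n-2m+1)+(k-n+2m-1)(2m+n-k)\quad\text{if } k>n-2m+1.$$ In particular, for the standard representation $r_{\rho_1}(\xi)\le 4m$, and (when $n\ge2$) $r_{\rho_2}(\xi)\le 8m$ if $2m<n$ and $r_{\rho_2}(\xi)\le 8m-2$ if $2m=n$.
   Context: General setting. Let $G$ be a compact connected Lie group with Lie algebra $\mathfrak g$, $\mathfrak t\subset\mathfrak g$ a maximal torus (maximal abelian subalgebra), $\alpha_1,\ldots,\alpha_n\in\sqrt{-1}\,\mathfrak t^*$ the positive simple roots for a chosen set of positive roots $\Delta^+$, and $H_1,\ldots,H_n\in\mathfrak t$ the dual basis: $\alpha_i(H_j)=\sqrt{-1}\,\delta_{ij}$. Put $\mathfrak I(G)=\{\xi\in\mathfrak t:\exp_G(2\pi\xi)=e\}$, $\mathfrak I'(G)=\{\xi\in\mathfrak I(G): \alpha(\xi)/\sqrt{-1}\ge 0 \text{ for all }\alpha\in\Delta^+\}$ and $\mathfrak I^2(G)=\{\xi\in\mathfrak t:\exp_G(\pi\xi)=e\}$. For $\xi\in\mathfrak I'(G)$ let $\mathfrak g^\xi_j$ be the $\sqrt{-1}\,j$-eigenspace of $\mathrm{ad}\,\xi$ on $\mathfrak g^{\mathbb C}$ and $\mathfrak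 p_i^\xi=\bigoplus_{j\le i}\mathfrak g_j^\xi$. Define $\xi\preceq\xi'$ iff $\mathfrak p^\xi_i\subseteq\mathfrak p^{\xi'}_i$ for all $i\ge 0$ (writing $\xi=\sum n_iH_i$, $\xi'=\sum n_i'H_i$, this is equivalent to $n_i'\le n_i$ for all $i$), and $\xi\preceq_{\mathcal I}\xi'$ iff $\xi\preceq\xi'$ and $\xi-\xi'\in\mathfrak I^2(G)$. A symmetric canonical element of $G$ is a maximal element of $(\mathfrak I'(G),\preceq_{\mathcal I})$. For $\xi\in\mathfrak I'(G)$, $\gamma_\xi:S^1\to G$ is the homomorphism $\gamma_\xi(\lambda)=\exp_G(-\sqrt{-1}\ln(\lambda)\,\xi)$, so $\gamma_\xi(-1)=\exp_G(\pi\xi)$, and $N_\xi=\{g\gamma_\xi(-1)g^{-1}: g\in G\}$. Uniton number. If $\rho$ is an irreducible representation of $\mathfrak g^{\mathbb C}$ with highest weight $\omega^*$ and lowest weight $\varpi^*$, then $r_\rho(\xi):=\frac{1}{\sqrt{-1}}\big(\omega^*(\xi)-\varpi^*(\xi)\big)$. The case $(C_n)$. $G=Sp(n)=\{X\in U(2n): XJ=JX\}$, where $J:\mathbb C^{2n}\to\mathbb C^{2n}$ is the anti-linear map representing left multiplication by the quaternion $j$. With respect to an orthonormal basis $e_1,\ldots,e_{2n}$ of $\mathbb C^{2n}$ with $e_{n+i}=Je_i$, $E_i$ is the diagonal matrix with $E_ie_i=\sqrt{-1}e_i$, $E_ie_{n+i}=-\sqrt{-1}e_{n+i}$ and zero on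 the other basis vectors. $\mathfrak t=\{\sum a_iE_i\}$, $L_i(E_j)=\sqrt{-1}\,\delta_{ij}$. $\Delta^+=\{L_i+L_j\}_{i\le j}\cup\{L_i-L_j\}_{i<j}$, with simple roots $\alpha_i=L_i-L_{i+1}$ ($i\le n-1$), $\alpha_n=2L_n$, so $H_i=E_1+\ldots+E_i$ for $i\le n-1$ and $H_n=\frac12(E_1+\ldots+E_n)$. The fundamental weights are $\omega_i=L_1+\ldots+L_i$ ($1\le i\le n$), and $\rho_k$ is the irreducible representation with highest weight $\omega_k$. Quaternionic Grassmannian. $G^{\mathbb H}_m(n)$ is the set of $J$-stable complex subspaces $V\subset\mathbb C^{2n}\cong\mathbb H^n$ of quaternionic dimension $m$ (complex dimension $2m$), and $\iota:G^{\mathbb H}_m(n)\to Sp(n)$ is $\iota(V)=\pi_V^\perp-\pi_V$, where $\pi_V$ is the orthogonal projection onto $V$ and $\pi_V^\perp=\mathrm{Id}-\pi_V$. *)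

theory Defs
  imports
    "HOL-Analysis.Complex_Transcendental"
    "HOL-Library.FuncSet"
    "Jordan_Normal_Form.Schur_Decomposition"
begin

unbundle no vec_syntax
hide_type (open) Finite_Cartesian_Product.vec
hide_const (open) Finite_Cartesian_Product.mat Finite_Cartesian_Product.vec
  Finite_Cartesian_Product.vec_nth Real_Vector_Spaces.subspace Real_Vector_Spaces.dim

(* Basis vectors of C^{2n} are numbered from 0: e_{i+1} is unit_vec (2*n) i, and
   J e_{i+1} is unit_vec (2*n) (n+i), for i < n. *)

section \<open>The group Sp(n), its Lie algebra and its maximal torus\<close>

(* the antilinear map with J e_i = e_{n+i} and J e_{n+i} = - e_i *)
definition quatJ :: "nat \<Rightarrow> complex vec \<Rightarrow> complex vec" where
  "quatJ n v = vec (2 * n) (\<lambda>a. if a < n then - cnj (v $ (n + a)) else cnj (v $ (a - n)))"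

definition commutes_with_J :: "nat \<Rightarrow> complex mat \<Rightarrow> bool" where
  "commutes_with_J n X \<longleftrightarrow>
     (\<forall>v \<in> carrier_vec (2 * n). X *\<^sub>v quatJ n v = quatJ n (X *\<^sub>v v))"

definition Sp :: "nat \<Rightarrow> complex mat set" where
  "Sp n = {X \<in> carrier_mat (2 * n) (2 * n).
             mat_adjoint X * X = 1\<^sub>m (2 * n) \<and> commutes_with_J n X}"

definition sp_alg :: "nat \<Rightarrow> complex mat set" where
  "sp_alg n = {X \<in> carrier_mat (2 * n) (2 * n).
                 mat_adjoint X = - X \<and> commutes_with_J n X}"

(* The complexification, realised inside gl(2n,C); the sum is direct because sp(n)
   consists of skew-Hermitian matrices. *)
definition sp_algC :: "nat \<Rightarrow> complex mat set" where
  "sp_algC n = {X + \<i> \<cdot>\<^sub>m Y | X Y. X \<in> sp_alg n \<and> Y \<in> sp_alg n}"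

definition bracket :: "complex mat \<Rightarrow> complex mat \<Rightarrow> complex mat" where
  "bracket X Y = X * Y - Y * X"

(* a_0 E_1 + ... + a_{n-1} E_n *)
definition torus_elt :: "nat \<Rightarrow> (nat \<Rightarrow> real) \<Rightarrow> complex mat" where
  "torus_elt n a = mat (2 * n) (2 * n) (\<lambda>(r, c).
     if r \<noteq> c then 0
     else if r < n then \<i> * of_real (a r)
     else - \<i> * of_real (a (r - n)))"

definition torus :: "nat \<Rightarrow> complex mat set" where
  "torus n = range (torus_elt n)"

(* For i < n this is L_{i+1}: on a_0 E_1 + ... + a_{n-1} E_n it takes the value
   sqrt(-1) a_i, which is the i-th diagonal entry. *)
definition L :: "nat \<Rightarrow> complex mat \<Rightarrow> complex" where
  "L i \<xi> = \<xi> $$ (i, i)"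

definition pos_roots :: "nat \<Rightarrow> (complex mat \<Rightarrow> complex) set" where
  "pos_roots n = {\<lambda>\<xi>. L i \<xi> + L j \<xi> | i j. i \<le> j \<and> j < n} \<union>
                 {\<lambda>\<xi>. L i \<xi> - L j \<xi> | i j. i < j \<and> j < n}"

definition mat_exp :: "complex mat \<Rightarrow> complex mat" where
  "mat_exp A = mat (dim_row A) (dim_row A) (\<lambda>(i, j). \<Sum>k. (A ^\<^sub>m k) $$ (i, j) / fact k)"


section \<open>Symmetric canonical elements\<close>

definition int_lattice :: "nat \<Rightarrow> complex mat set" where
  "int_lattice n = {\<xi> \<in> torus n. mat_exp (complex_of_real (2 * pi) \<cdot>\<^sub>m \<xi>) = 1\<^sub>m (2 * n)}"

(* Re only changes the type: roots are purely imaginary on the torus *)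
definition int_lattice_dom :: "nat \<Rightarrow> complex mat set" where
  "int_lattice_dom n = {\<xi> \<in> int_lattice n. \<forall>\<alpha> \<in> pos_roots n. Re (\<alpha> \<xi> / \<i>) \<ge> 0}"

definition int_lattice2 :: "nat \<Rightarrow> complex mat set" where
  "int_lattice2 n = {\<xi> \<in> torus n. mat_exp (complex_of_real pi \<cdot>\<^sub>m \<xi>) = 1\<^sub>m (2 * n)}"

definition ad_eigenspace :: "nat \<Rightarrow> complex mat \<Rightarrow> int \<Rightarrow> complex mat set" where
  "ad_eigenspace n \<xi> j = {X \<in> sp_algC n. bracket \<xi> X = (\<i> * of_int j) \<cdot>\<^sub>m X}"

(* the direct sum of the eigenspaces for all integers j \<le> i *)
definition parab :: "nat \<Rightarrow> complex mat \<Rightarrow> int \<Rightarrow> complex mat set" where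
  "parab n \<xi> i = {finsum (module_mat TYPE(complex) (2 * n) (2 * n)) X F | X F.
     finite F \<and> F \<subseteq> {..i} \<and> (\<forall>j \<in> F. X j \<in> ad_eigenspace n \<xi> j)}"

definition prec :: "nat \<Rightarrow> complex mat \<Rightarrow> complex mat \<Rightarrow> bool" where
  "prec n \<xi> \<xi>' \<longleftrightarrow> (\<forall>i \<ge> 0. parab n \<xi> i \<subseteq> parab n \<xi>' i)"

definition prec_I :: "nat \<Rightarrow> complex mat \<Rightarrow> complex mat \<Rightarrow> bool" where
  "prec_I n \<xi> \<xi>' \<longleftrightarrow> prec n \<xi> \<xi>' \<and> \<xi> - \<xi>' \<in> int_lattice2 n"

definition symmetric_canonical :: "nat \<Rightarrow> complex mat \<Rightarrow> bool" where
  "symmetric_canonical n \<xi> \<longleftrightarrow> \<xi> \<in> int_lattice_dom n \<and>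
     (\<forall>\<xi>' \<in> int_lattice_dom n. prec_I n \<xi> \<xi>' \<longrightarrow> \<xi>' = \<xi>)"

(* For \<xi> in the integer lattice the value does not depend on the branch of the logarithm. *)
definition gamma :: "complex mat \<Rightarrow> complex \<Rightarrow> complex mat" where
  "gamma \<xi> z = mat_exp ((- \<i> * Ln z) \<cdot>\<^sub>m \<xi>)"

(* the inverse of a unitary matrix is its adjoint *)
definition N_orbit :: "nat \<Rightarrow> complex mat \<Rightarrow> complex mat set" where
  "N_orbit n \<xi> = {g * gamma \<xi> (-1) * mat_adjoint g | g. g \<in> Sp n}"


section \<open>Quaternionic Grassmannians\<close>

abbreviation csubspace_of :: "complex vec set \<Rightarrow> nat \<Rightarrow> bool" where
  "csubspace_of V d \<equiv> VectorSpace.subspace class_ring V (module_vec TYPE(complex) d)"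

definition quat_grass :: "nat \<Rightarrow> nat \<Rightarrow> complex vec set set" where
  "quat_grass m n = {V. csubspace_of V (2 * n) \<and> (\<forall>v \<in> V. quatJ n v \<in> V) \<and>
     vectorspace.dim class_ring ((module_vec TYPE(complex) (2 * n))\<lparr>carrier := V\<rparr>) = 2 * m}"

definition orth_proj :: "nat \<Rightarrow> complex vec set \<Rightarrow> complex mat" where
  "orth_proj d V = (THE P. P \<in> carrier_mat d d \<and>
     (\<forall>v \<in> carrier_vec d. P *\<^sub>v v \<in> V \<and> (\<forall>w \<in> V. (v - P *\<^sub>v v) \<bullet>c w = 0)))"

definition iota :: "nat \<Rightarrow> complex vec set \<Rightarrow> complex mat" where
  "iota n V = (1\<^sub>m (2 * n) - orth_proj (2 * n) V) - orth_proj (2 * n) V"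


section \<open>Representations of the complexified Lie algebra and their weights\<close>

(* a complex representation on C^d; every finite-dimensional representation is isomorphic
   to one of this form *)
definition is_rep :: "nat \<Rightarrow> nat \<Rightarrow> (complex mat \<Rightarrow> complex mat) \<Rightarrow> bool" where
  "is_rep n d \<rho> \<longleftrightarrow>
     (\<forall>X \<in> sp_algC n. \<rho> X \<in> carrier_mat d d) \<and>
     (\<forall>X \<in> sp_algC n. \<forall>Y \<in> sp_algC n. \<rho> (X + Y) = \<rho> X + \<rho> Y) \<and>
     (\<forall>c. \<forall>X \<in> sp_algC n. \<rho> (c \<cdot>\<^sub>m X) = c \<cdot>\<^sub>m \<rho> X) \<and>
     (\<forall>X \<in> sp_algC n. \<forall>Y \<in> sp_algC n. \<rho> (bracket X Y) = bracket (\<rho> X) (\<rho> Y))"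

definition is_irrep :: "nat \<Rightarrow> nat \<Rightarrow> (complex mat \<Rightarrow> complex mat) \<Rightarrow> bool" where
  "is_irrep n d \<rho> \<longleftrightarrow> is_rep n d \<rho> \<and> d > 0 \<and>
     (\<forall>W. csubspace_of W d \<and> (\<forall>X \<in> sp_algC n. \<forall>w \<in> W. \<rho> X *\<^sub>v w \<in> W)
        \<longrightarrow> W = {0\<^sub>v d} \<or> W = carrier_vec d)"

(* Weights are functionals on the torus, represented by functions that are undefined
   outside of it, so that two weights are equal iff they agree on the torus. *)
definition is_weight ::
  "nat \<Rightarrow> nat \<Rightarrow> (complex mat \<Rightarrow> complex mat) \<Rightarrow> (complex mat \<Rightarrow> complex) \<Rightarrow> bool" where
  "is_weight n d \<rho> \<mu> \<longleftrightarrow> \<mu> \<in> extensional (torus n) \<and>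
     (\<exists>v \<in> carrier_vec d. v \<noteq> 0\<^sub>v d \<and> (\<forall>\<xi> \<in> torus n. \<rho> \<xi> *\<^sub>v v = \<mu> \<xi> \<cdot>\<^sub>v v))"

(* \<mu> is lower than \<nu>: \<nu> - \<mu> is a (possibly empty) sum of positive roots *)
definition weight_le ::
  "nat \<Rightarrow> (complex mat \<Rightarrow> complex) \<Rightarrow> (complex mat \<Rightarrow> complex) \<Rightarrow> bool" where
  "weight_le n \<mu> \<nu> \<longleftrightarrow> (\<exists>c :: (complex mat \<Rightarrow> complex) \<Rightarrow> nat.
     \<forall>\<xi> \<in> torus n. \<nu> \<xi> - \<mu> \<xi> = (\<Sum>\<alpha> \<in> pos_roots n. of_nat (c \<alpha>) * \<alpha> \<xi>))"

definition is_highest_weight ::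
  "nat \<Rightarrow> nat \<Rightarrow> (complex mat \<Rightarrow> complex mat) \<Rightarrow> (complex mat \<Rightarrow> complex) \<Rightarrow> bool" where
  "is_highest_weight n d \<rho> \<omega> \<longleftrightarrow> is_weight n d \<rho> \<omega> \<and>
     (\<forall>\<mu>. is_weight n d \<rho> \<mu> \<longrightarrow> weight_le n \<mu> \<omega>)"

definition is_lowest_weight ::
  "nat \<Rightarrow> nat \<Rightarrow> (complex mat \<Rightarrow> complex mat) \<Rightarrow> (complex mat \<Rightarrow> complex) \<Rightarrow> bool" where
  "is_lowest_weight n d \<rho> \<omega> \<longleftrightarrow> is_weight n d \<rho> \<omega> \<and>
     (\<forall>\<mu>. is_weight n d \<rho> \<mu> \<longrightarrow> weight_le n \<omega> \<mu>)"

definition highest_weight ::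
  "nat \<Rightarrow> nat \<Rightarrow> (complex mat \<Rightarrow> complex mat) \<Rightarrow> complex mat \<Rightarrow> complex" where
  "highest_weight n d \<rho> = (THE \<omega>. is_highest_weight n d \<rho> \<omega>)"

definition lowest_weight ::
  "nat \<Rightarrow> nat \<Rightarrow> (complex mat \<Rightarrow> complex mat) \<Rightarrow> complex mat \<Rightarrow> complex" where
  "lowest_weight n d \<rho> = (THE \<omega>. is_lowest_weight n d \<rho> \<omega>)"

(* Re only changes the type: weights are purely imaginary on the torus *)
definition r_number :: "nat \<Rightarrow> nat \<Rightarrow> (complex mat \<Rightarrow> complex mat) \<Rightarrow> complex mat \<Rightarrow> real" where
  "r_number n d \<rho> \<xi> = Re (1 / \<i> * (highest_weight n d \<rho> \<xi> - lowest_weight n d \<rho> \<xi>))"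

definition fund_weight :: "nat \<Rightarrow> nat \<Rightarrow> complex mat \<Rightarrow> complex" where
  "fund_weight n k = restrict (\<lambda>\<xi>. \<Sum>i<k. L i \<xi>) (torus n)"

(* \<rho> is (a model on C^d of) the k-th fundamental representation *)
definition is_fund_rep :: "nat \<Rightarrow> nat \<Rightarrow> nat \<Rightarrow> (complex mat \<Rightarrow> complex mat) \<Rightarrow> bool" where
  "is_fund_rep n k d \<rho> \<longleftrightarrow>
     is_irrep n d \<rho> \<and> is_highest_weight n d \<rho> (fund_weight n k)"

end

theory Submission
  imports Defs
begin

text \<open>
  Write \<open>\<xi> = a\<^sub>0 E\<^sub>1 + \<dots> + a\<^bsub>n-1\<^esub> E\<^sub>n\<close>. Membership in the dominant integer
  lattice says that the \<open>a\<^sub>i\<close> are integers with \<open>a\<^sub>0 \<ge> a\<^sub>1 \<ge> \<dots> \<ge> 0\<close>, and the theorem becomes a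
  statement about such sequences, once three facts are known.

  Maximality of \<open>\<xi>\<close> means that the sequence has no gaps: every integer from \<open>1\<close> to \<open>a\<^sub>0\<close> occurs
  (lemma \<open>symmetric_canonical_attains\<close>). If \<open>t + 1\<close> were skipped, subtracting \<open>2\<close> from all entries
  above \<open>t\<close> would keep the sequence dominant and its parities unchanged, and would yield a strictly
  larger element.

  The hypothesis on \<open>N\<^sub>\<xi>\<close> says that exactly \<open>m\<close> of the \<open>a\<^sub>i\<close> are odd (lemma \<open>card_odd_of_orbit\<close>):
  \<open>\<gamma>\<^sub>\<xi>(-1)\<close> is diagonal with entries \<open>(-1)\<close> to the power \<open>a\<^sub>i\<close>, each occurring twice, while \<open>\<iota>(V)\<close>
  has \<open>2 m\<close> eigenvalues \<open>-1\<close>; so it suffices to compare traces, for one convenient \<open>V\<close>.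

  The Weyl group of \<open>Sp(n)\<close> contains \<open>-1\<close>, so the lowest weight of \<open>\<rho>\<^sub>k\<close> is minus the highest one
  and \<open>r(\<xi>) = 2 (a\<^sub>0 + \<dots> + a\<^bsub>k-1\<^esub>)\<close> (lemma \<open>r_number_fund_rep\<close>). The element \<open>-1\<close> is the product
  of the reflections in the long roots \<open>2 L\<^sub>i\<close>, and invariance of the set of weights under one
  reflection is a statement about representations of \<open>sl\<^sub>2\<close> (lemmas \<open>F_power_nonzero\<close> and
  \<open>weight_reflect\<close>).

  In a nonincreasing sequence without gaps, the values \<open>1, \<dots>, a\<^sub>i\<close> all occur at the \<open>n - i\<close> places
  from \<open>i\<close> on, so \<open>a\<^sub>i \<le> n - i\<close>; and the odd values up to \<open>a\<^sub>i\<close> occur, so \<open>a\<^sub>i \<le> 2 m\<close>. Summing the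
  smaller of the two bounds over \<open>i < k\<close> gives the two cases of the theorem.
\<close>

section \<open>Matrix coordinates on the torus and on the Lie algebra\<close>

text \<open>
  The involution \<open>e\<^sub>i \<leftrightarrow> J e\<^sub>i\<close> on the numbers of the
  basis vectors. With the sign \<open>+1\<close> on the first half and \<open>-1\<close> on the
  second, it turns \<open>J\<close> into a formula without case distinction.
\<close>
definition dual_idx :: "nat \<Rightarrow> nat \<Rightarrow> nat" where
  "dual_idx n r = (if r < n then n + r else r - n)"

definition idx_sign :: "nat \<Rightarrow> nat \<Rightarrow> complex" where
  "idx_sign n r = (if r < n then 1 else - 1)"

definition diag_entry :: "nat \<Rightarrow> (nat \<Rightarrow> real) \<Rightarrow> nat \<Rightarrow> real" where
  "diag_entry n a r = (if r < n then a r else - a (r - n))"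

lemma dual_idx_less [simp]: "r < 2 * n \<Longrightarrow> dual_idx n r < 2 * n"
  by (auto simp: dual_idx_def)

lemma dual_idx_dual_idx [simp]: "r < 2 * n \<Longrightarrow> dual_idx n (dual_idx n r) = r"
  by (auto simp: dual_idx_def)

lemma idx_sign_dual_idx: "r < 2 * n \<Longrightarrow> idx_sign n (dual_idx n r) = - idx_sign n r"
  by (auto simp: dual_idx_def idx_sign_def)

lemma idx_sign_simps [simp]:
  "idx_sign n r * idx_sign n r = 1" "idx_sign n r * (idx_sign n r * z) = z"
  "cnj (idx_sign n r) = idx_sign n r"
  by (auto simp: idx_sign_def)

lemma diag_entry_dual_idx: "r < 2 * n \<Longrightarrow> diag_entry n a (dual_idx n r) = - diag_entry n a r"
  by (auto simp: dual_idx_def diag_entry_def)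

lemma sum_dual_idx: "(\<Sum>r<2 * n. f (dual_idx n r)) = (\<Sum>r<2 * n. f r)"
  by (rule sum.reindex_bij_witness[of _ "dual_idx n" "dual_idx n"]) auto

lemma torus_elt_carrier [simp]: "torus_elt n a \<in> carrier_mat (2 * n) (2 * n)"
  by (simp add: torus_elt_def)

lemma torus_elt_index [simp]:
  "r < 2 * n \<Longrightarrow> c < 2 * n \<Longrightarrow>
     torus_elt n a $$ (r, c) = (if r = c then \<i> * of_real (diag_entry n a r) else 0)"
  by (auto simp: torus_elt_def diag_entry_def)

lemma L_torus_elt: "i < n \<Longrightarrow> L i (torus_elt n a) = \<i> * of_real (a i)"
  by (simp add: L_def diag_entry_def)

lemma torus_elt_eq_mat_diag: "torus_elt n a = mat_diag (2 * n) (\<lambda>r. \<i> * of_real (diag_entry n a r))"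
  by (rule eq_matI) (auto simp: mat_diag_def torus_elt_def diag_entry_def)

lemma mat_adjoint_index:
  "i < dim_col A \<Longrightarrow> j < dim_row A \<Longrightarrow> mat_adjoint A $$ (i, j) = cnj (A $$ (j, i))"
  "dim_row (mat_adjoint A) = dim_col A" "dim_col (mat_adjoint A) = dim_row A"
  by (auto simp: mat_adjoint_def mat_of_rows_def)

lemma quatJ_index: "r < 2 * n \<Longrightarrow> quatJ n v $ r = - idx_sign n r * cnj (v $ dual_idx n r)"
  by (auto simp: quatJ_def idx_sign_def dual_idx_def)

lemma quatJ_carrier [simp]: "quatJ n v \<in> carrier_vec (2 * n)"
  by (simp add: quatJ_def)

lemma mult_mat_vec_index_sum:
  "X \<in> carrier_mat d e \<Longrightarrow> v \<in> carrier_vec e \<Longrightarrow> r < d \<Longrightarrow>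
     (X *\<^sub>v v) $ r = (\<Sum>c<e. X $$ (r, c) * v $ c)"
  by (auto simp: scalar_prod_def atLeast0LessThan)

text \<open>
  Comparing the two sides on unit vectors gives the entrywise condition; conversely the condition
  makes the two sums over the columns agree after reindexing by the involution.
\<close>
lemma commutes_with_J_iff:
  assumes X: "X \<in> carrier_mat (2 * n) (2 * n)"
  shows "commutes_with_J n X \<longleftrightarrow>
    (\<forall>r<2 * n. \<forall>c<2 * n. X $$ (dual_idx n r, dual_idx n c)
        = idx_sign n r * idx_sign n c * cnj (X $$ (r, c)))"
    (is "_ \<longleftrightarrow> ?entries")
proof -
  have left: "(X *\<^sub>v quatJ n v) $ r
      = (\<Sum>c<2 * n. X $$ (r, dual_idx n c) * (idx_sign n c * cnj (v $ c)))"
    if "v \<in> carrier_vec (2 * n)" "r < 2 * n" for v r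
  proof -
    have "(X *\<^sub>v quatJ n v) $ r
        = (\<Sum>c<2 * n. X $$ (r, c) * (- idx_sign n c * cnj (v $ dual_idx n c)))"
      using X that by (simp add: mult_mat_vec_index_sum quatJ_index del: index_mult_mat_vec)
    also have "\<dots> = (\<Sum>c<2 * n. X $$ (r, dual_idx n c)
        * (- idx_sign n (dual_idx n c) * cnj (v $ dual_idx n (dual_idx n c))))"
      by (rule sum_dual_idx[symmetric])
    finally show ?thesis by (simp add: idx_sign_dual_idx)
  qed
  have right: "quatJ n (X *\<^sub>v v) $ r
      = (\<Sum>c<2 * n. - idx_sign n r * cnj (X $$ (dual_idx n r, c)) * cnj (v $ c))"
    if "v \<in> carrier_vec (2 * n)" "r < 2 * n" for v r
    using X that by (simp add: quatJ_index mult_mat_vec_index_sum sum_distrib_left mult.assoc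
        sum_negf del: index_mult_mat_vec)
  show ?thesis
  proof
    assume J: "commutes_with_J n X"
    show ?entries
    proof (intro allI impI)
      fix r c assume r: "r < 2 * n" and c: "c < 2 * n"
      let ?u = "unit_vec (2 * n) c :: complex vec" and ?r = "dual_idx n r"
      have "(X *\<^sub>v quatJ n ?u) $ ?r = quatJ n (X *\<^sub>v ?u) $ ?r"
        using J by (simp add: commutes_with_J_def del: index_mult_mat_vec)
      then have "X $$ (?r, dual_idx n c) * idx_sign n c = idx_sign n r * cnj (X $$ (r, c))"
        using r c by (simp add: left right idx_sign_dual_idx unit_vec_def if_distrib if_distribR
            cong: if_cong del: index_mult_mat_vec)
      then have "X $$ (?r, dual_idx n c) * idx_sign n c * idx_sign n c
          = idx_sign n r * cnj (X $$ (r, c)) * idx_sign n c"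
        by simp
      then show "X $$ (?r, dual_idx n c) = idx_sign n r * idx_sign n c * cnj (X $$ (r, c))"
        by (simp add: mult_ac)
    qed
  next
    assume E: ?entries
    have E': "X $$ (r, dual_idx n c) * idx_sign n c
        = - idx_sign n r * cnj (X $$ (dual_idx n r, c))" if "r < 2 * n" "c < 2 * n" for r c
    proof -
      have "X $$ (r, dual_idx n c) = - idx_sign n r * idx_sign n c * cnj (X $$ (dual_idx n r, c))"
        using E[rule_format, of "dual_idx n r" c] that by (simp add: idx_sign_dual_idx)
      then show ?thesis by (simp add: mult_ac)
    qed
    show "commutes_with_J n X"
      unfolding commutes_with_J_def
    proof (intro ballI eq_vecI)
      fix v :: "complex vec" and r
      assume v: "v \<in> carrier_vec (2 * n)" and "r < dim_vec (quatJ n (X *\<^sub>v v))"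
      then have r: "r < 2 * n" by (simp add: quatJ_def)
      show "(X *\<^sub>v quatJ n v) $ r = quatJ n (X *\<^sub>v v) $ r"
        unfolding left[OF v r] right[OF v r]
        by (rule sum.cong) (use E' r in \<open>auto simp: mult.assoc[symmetric]\<close>)
    qed (use X in \<open>auto simp: quatJ_def\<close>)
  qed
qed

lemma mem_sp_alg_iff:
  "X \<in> sp_alg n \<longleftrightarrow> X \<in> carrier_mat (2 * n) (2 * n) \<and>
     (\<forall>r<2 * n. \<forall>c<2 * n. cnj (X $$ (c, r)) = - X $$ (r, c)) \<and>
     (\<forall>r<2 * n. \<forall>c<2 * n. X $$ (dual_idx n r, dual_idx n c)
        = idx_sign n r * idx_sign n c * cnj (X $$ (r, c)))"
proof (cases "X \<in> carrier_mat (2 * n) (2 * n)")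
  case True
  then have "mat_adjoint X = - X \<longleftrightarrow>
      (\<forall>r<2 * n. \<forall>c<2 * n. cnj (X $$ (c, r)) = - X $$ (r, c))"
    by (auto simp: mat_eq_iff mat_adjoint_index)
  with True show ?thesis
    by (simp add: sp_alg_def commutes_with_J_iff)
qed (auto simp: sp_alg_def)

text \<open>
  On \<open>sp(n)\<close>, skew-Hermitian symmetry turns the conjugation in the
  \<open>J\<close>-condition into a transposition, and the condition becomes complex linear.
  Conversely, a matrix satisfying the linear condition is the sum of its skew-Hermitian part and
  of \<open>\<i>\<close> times a skew-Hermitian matrix, and both parts inherit the condition. The
  entries \<open>(r, c)\<close> and \<open>(dual_idx n c, dual_idx n r)\<close> that it relates
  have the same weight under the torus, which is why the algebra is closed under splitting a
  matrix into its weight components.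
\<close>
lemma mem_sp_algC_iff:
  "X \<in> sp_algC n \<longleftrightarrow> X \<in> carrier_mat (2 * n) (2 * n) \<and>
     (\<forall>r<2 * n. \<forall>c<2 * n. X $$ (dual_idx n c, dual_idx n r)
        = - idx_sign n r * idx_sign n c * X $$ (r, c))"
    (is "_ \<longleftrightarrow> ?carr \<and> ?entries")
proof (intro iffI conjI allI impI)
  assume "X \<in> sp_algC n"
  then obtain U W where X: "X = U + \<i> \<cdot>\<^sub>m W" and U: "U \<in> sp_alg n" and W: "W \<in> sp_alg n"
    by (auto simp: sp_algC_def)
  have carr: "U \<in> carrier_mat (2 * n) (2 * n)" "W \<in> carrier_mat (2 * n) (2 * n)"
    using U W by (auto simp: sp_alg_def)
  then show ?carr by (simp add: X)
  fix r c assume r: "r < 2 * n" and c: "c < 2 * n"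
  have *: "Z $$ (dual_idx n c, dual_idx n r) = - idx_sign n r * idx_sign n c * Z $$ (r, c)"
    if "Z \<in> sp_alg n" for Z
    using that r c unfolding mem_sp_alg_iff by simp
  show "X $$ (dual_idx n c, dual_idx n r) = - idx_sign n r * idx_sign n c * X $$ (r, c)"
    using carr r c *[OF U] *[OF W] by (simp add: X) (simp add: algebra_simps)
next
  assume "?carr \<and> ?entries"
  then have X: ?carr and E: ?entries by blast+
  define U where "U = mat (2 * n) (2 * n) (\<lambda>(r, c). (X $$ (r, c) - cnj (X $$ (c, r))) / 2)"
  define W where "W = mat (2 * n) (2 * n) (\<lambda>(r, c). - \<i> * (X $$ (r, c) + cnj (X $$ (c, r))) / 2)"
  have "X = U + \<i> \<cdot>\<^sub>m W"
    using X by (auto intro!: eq_matI simp: U_def W_def field_simps)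
  moreover have "U \<in> sp_alg n"
    unfolding mem_sp_alg_iff using E by (auto simp: U_def) (auto simp: field_simps)
  moreover have "W \<in> sp_alg n"
    unfolding mem_sp_alg_iff using E by (auto simp: W_def) (auto simp: field_simps)
  ultimately show "X \<in> sp_algC n"
    by (auto simp: sp_algC_def)
qed

lemma torus_elt_in_sp_algC: "torus_elt n a \<in> sp_algC n"
  unfolding mem_sp_algC_iff
proof (intro conjI allI impI)
  fix r c assume rc: "r < 2 * n" "c < 2 * n"
  then have "dual_idx n c = dual_idx n r \<longleftrightarrow> r = c"
    by (metis dual_idx_dual_idx)
  then show "torus_elt n a $$ (dual_idx n c, dual_idx n r)
      = - idx_sign n r * idx_sign n c * torus_elt n a $$ (r, c)"
    using rc by (simp add: diag_entry_dual_idx)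
qed simp

lemma pow_mat_diag: "mat_diag d f ^\<^sub>m k = mat_diag d (\<lambda>i. f i ^ k)" for f :: "nat \<Rightarrow> 'a :: semiring_1"
proof (induction k)
  case 0
  then show ?case by (simp add: mat_diag_def)
next
  case (Suc k)
  have "mat_diag d f ^\<^sub>m Suc k = mat_diag d (\<lambda>i. f i ^ k) * mat_diag d f" by (simp add: Suc)
  then show ?case by (simp add: power_commutes)
qed

lemma mat_exp_mat_diag: "mat_exp (mat_diag d f) = mat_diag d (\<lambda>i. exp (f i))"
  by (rule eq_matI)
    (auto simp: mat_exp_def pow_mat_diag, auto simp: mat_diag_def exp_def scaleR_conv_of_real field_simps)

lemma mat_exp_smult_torus_elt:
  "mat_exp (z \<cdot>\<^sub>m torus_elt n a) = mat_diag (2 * n) (\<lambda>r. exp (z * \<i> * of_real (diag_entry n a r)))"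
proof -
  have "z \<cdot>\<^sub>m torus_elt n a = mat_diag (2 * n) (\<lambda>r. z * \<i> * of_real (diag_entry n a r))"
    by (rule eq_matI) (auto simp: torus_elt_eq_mat_diag mat_diag_def)
  then show ?thesis by (simp add: mat_exp_mat_diag)
qed

lemma mat_diag_eq_one_iff: "mat_diag d f = 1\<^sub>m d \<longleftrightarrow> (\<forall>i<d. f i = 1)"
  by (auto simp: mat_eq_iff mat_diag_def)

lemma exp_torus_elt_eq_one_iff:
  "mat_exp (complex_of_real (2 * s) \<cdot>\<^sub>m torus_elt n a) = 1\<^sub>m (2 * n) \<longleftrightarrow>
     (\<forall>i<n. exp (\<i> * of_real (2 * s * a i)) = 1)"
proof -
  have inv: "exp (- w) = 1 \<longleftrightarrow> exp w = 1" for w :: complex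
    by (auto simp: exp_minus)
  have "(\<forall>r<2 * n. exp (complex_of_real (2 * s) * \<i> * of_real (diag_entry n a r)) = 1) \<longleftrightarrow>
      (\<forall>i<n. exp (\<i> * of_real (2 * s * a i)) = 1)" (is "?A \<longleftrightarrow> ?B")
  proof
    assume A: ?A
    show ?B
    proof (intro allI impI)
      fix i assume "i < n"
      then show "exp (\<i> * of_real (2 * s * a i)) = 1"
        using A[rule_format, of i] by (simp add: diag_entry_def mult_ac)
    qed
  next
    assume B: ?B
    show ?A
    proof (intro allI impI)
      fix r assume r: "r < 2 * n"
      show "exp (complex_of_real (2 * s) * \<i> * of_real (diag_entry n a r)) = 1"
      proof (cases "r < n")
        case True
        then show ?thesis using B[rule_format, of r] by (simp add: diag_entry_def mult_ac)
      next
        case False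
        then have "exp (\<i> * of_real (2 * s * a (r - n))) = 1" using B r by auto
        then have "exp (- (\<i> * of_real (2 * s * a (r - n)))) = 1" by (simp only: inv)
        then show ?thesis using False by (simp add: diag_entry_def mult_ac)
      qed
    qed
  qed
  then show ?thesis by (simp add: mat_exp_smult_torus_elt mat_diag_eq_one_iff)
qed

lemma exp_two_pi_eq_one_iff: "exp (\<i> * of_real (2 * pi * t)) = 1 \<longleftrightarrow> t \<in> \<int>" for t :: real
  by (auto simp: exp_eq_1 Ints_def)

lemma torus_elt_in_int_lattice_iff:
  "torus_elt n a \<in> int_lattice n \<longleftrightarrow> (\<forall>i<n. a i \<in> \<int>)"
  using exp_torus_elt_eq_one_iff[of pi n a]
  unfolding int_lattice_def exp_two_pi_eq_one_iff by (auto simp: torus_def)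

lemma torus_elt_in_int_lattice2_iff:
  "torus_elt n a \<in> int_lattice2 n \<longleftrightarrow> (\<forall>i<n. a i / 2 \<in> \<int>)"
proof -
  have "exp (\<i> * of_real (2 * (pi / 2) * t)) = 1 \<longleftrightarrow> t / 2 \<in> \<int>" for t :: real
    using exp_two_pi_eq_one_iff[of "t / 2"] by (simp add: field_simps)
  then show ?thesis
    using exp_torus_elt_eq_one_iff[of "pi / 2" n a] by (auto simp: int_lattice2_def torus_def)
qed

section \<open>The parabolic filtration\<close>

lemma finsum_mat:
  assumes "finite F" and "\<And>j. j \<in> F \<Longrightarrow> X j \<in> carrier_mat nr nc"
  shows finsum_mat_carrier: "finsum (module_mat TYPE(complex) nr nc) X F \<in> carrier_mat nr nc"
    and finsum_mat_index: "r < nr \<Longrightarrow> c < nc \<Longrightarrow>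
      finsum (module_mat TYPE(complex) nr nc) X F $$ (r, c) = (\<Sum>j\<in>F. X j $$ (r, c))"
proof -
  interpret M: abelian_group "module_mat TYPE(complex) nr nc" by (rule abelian_group_mat)
  have "finsum (module_mat TYPE(complex) nr nc) X F \<in> carrier_mat nr nc \<and>
      (r < nr \<longrightarrow> c < nc \<longrightarrow>
        finsum (module_mat TYPE(complex) nr nc) X F $$ (r, c) = (\<Sum>j\<in>F. X j $$ (r, c)))"
    using assms
  proof (induction F)
    case empty
    then show ?case by (simp add: M.finsum_empty module_mat_simps)
  next
    case (insert x F)
    have "finsum (module_mat TYPE(complex) nr nc) X (insert x F)
        = X x + finsum (module_mat TYPE(complex) nr nc) X F"
      using insert.hyps insert.prems
      by (subst M.finsum_insert) (auto simp: module_mat_simps)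
    with insert show ?case by auto
  qed
  then show "finsum (module_mat TYPE(complex) nr nc) X F \<in> carrier_mat nr nc"
    and "r < nr \<Longrightarrow> c < nc \<Longrightarrow>
      finsum (module_mat TYPE(complex) nr nc) X F $$ (r, c) = (\<Sum>j\<in>F. X j $$ (r, c))"
    by blast+
qed

lemma bracket_torus_elt:
  assumes "X \<in> carrier_mat (2 * n) (2 * n)"
  shows "bracket (torus_elt n a) X = mat (2 * n) (2 * n)
    (\<lambda>(r, c). \<i> * of_real (diag_entry n a r - diag_entry n a c) * X $$ (r, c))"
  unfolding bracket_def torus_elt_eq_mat_diag mat_diag_mult_left[OF assms] mat_diag_mult_right[OF assms]
  by (rule eq_matI) (auto simp: algebra_simps)

lemma mem_ad_eigenspace_iff:
  "X \<in> ad_eigenspace n (torus_elt n a) j \<longleftrightarrow> X \<in> sp_algC n \<and>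
     (\<forall>r<2 * n. \<forall>c<2 * n. X $$ (r, c) \<noteq> 0 \<longrightarrow> diag_entry n a r - diag_entry n a c = of_int j)"
proof (cases "X \<in> sp_algC n")
  case True
  then have X: "X \<in> carrier_mat (2 * n) (2 * n)" by (simp add: mem_sp_algC_iff)
  have "\<i> * of_real t * z = \<i> * of_int j * z \<longleftrightarrow> (z \<noteq> 0 \<longrightarrow> t = of_int j)" for t :: real and z
    using of_real_eq_iff[of t "of_int j", where 'a = complex] by auto
  with True X show ?thesis
    by (auto simp: ad_eigenspace_def bracket_torus_elt mat_eq_iff simp del: of_real_diff)
qed (simp add: ad_eigenspace_def)

text \<open>
  A torus element acts on the \<open>(r, c)\<close> entry by the difference of its diagonal
  entries at \<open>r\<close> and \<open>c\<close>. Grouping the entries by this difference splits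
  a matrix into eigenvectors, so the filtration only records which differences occur.
\<close>
lemma mem_parab_iff:
  assumes int: "\<forall>i<n. a i \<in> \<int>"
  shows "X \<in> parab n (torus_elt n a) i \<longleftrightarrow> X \<in> sp_algC n \<and>
     (\<forall>r<2 * n. \<forall>c<2 * n. X $$ (r, c) \<noteq> 0 \<longrightarrow> diag_entry n a r - diag_entry n a c \<le> of_int i)"
    (is "_ \<longleftrightarrow> _ \<and> ?bounded")
proof (intro iffI conjI allI impI)
  assume "X \<in> parab n (torus_elt n a) i"
  then obtain Y F where X: "X = finsum (module_mat TYPE(complex) (2 * n) (2 * n)) Y F"
    and F: "finite F" "F \<subseteq> {..i}"
    and Y: "\<And>j. j \<in> F \<Longrightarrow> Y j \<in> ad_eigenspace n (torus_elt n a) j"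
    by (auto simp: parab_def)
  have Y_alg: "Y j \<in> sp_algC n" if "j \<in> F" for j
    using Y[OF that] by (simp add: mem_ad_eigenspace_iff)
  then have carr: "\<And>j. j \<in> F \<Longrightarrow> Y j \<in> carrier_mat (2 * n) (2 * n)"
    by (simp add: mem_sp_algC_iff)
  have index: "X $$ (r, c) = (\<Sum>j\<in>F. Y j $$ (r, c))" if "r < 2 * n" "c < 2 * n" for r c
    using finsum_mat_index[OF F(1), of Y, OF carr] that by (simp add: X)
  show "X \<in> sp_algC n"
    unfolding mem_sp_algC_iff
  proof (intro conjI allI impI)
    show "X \<in> carrier_mat (2 * n) (2 * n)" unfolding X by (rule finsum_mat_carrier[OF F(1) carr])
    fix r c assume "r < 2 * n" "c < 2 * n"
    then show "X $$ (dual_idx n c, dual_idx n r) = - idx_sign n r * idx_sign n c * X $$ (r, c)"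
      using Y_alg by (simp add: index mem_sp_algC_iff sum_distrib_left sum_negf)
  qed
  fix r c assume rc: "r < 2 * n" "c < 2 * n" and "X $$ (r, c) \<noteq> 0"
  then obtain j where "j \<in> F" "Y j $$ (r, c) \<noteq> 0"
    by (metis index sum.neutral)
  with rc Y F show "diag_entry n a r - diag_entry n a c \<le> of_int i"
    by (auto simp: mem_ad_eigenspace_iff)
next
  assume "X \<in> sp_algC n \<and> ?bounded"
  then have X: "X \<in> sp_algC n" and bounded: ?bounded by blast+
  have carr: "X \<in> carrier_mat (2 * n) (2 * n)" using X by (simp add: mem_sp_algC_iff)
  define gap where "gap r c = \<lfloor>diag_entry n a r - diag_entry n a c\<rfloor>" for r c
  have gap: "of_int (gap r c) = diag_entry n a r - diag_entry n a c"
    if "r < 2 * n" "c < 2 * n" for r c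
  proof -
    have "diag_entry n a r \<in> \<int>" "diag_entry n a c \<in> \<int>"
      using int that by (auto simp: diag_entry_def)
    then show ?thesis by (auto simp: gap_def elim!: Ints_cases)
  qed
  \<comment> \<open>The finitely many degrees that occur, cut off at \<open>i\<close>.\<close>
  define F where "F = {j. \<exists>r<2 * n. \<exists>c<2 * n. gap r c = j \<and> j \<le> i}"
  define Y where "Y j = mat (2 * n) (2 * n) (\<lambda>(r, c). if gap r c = j then X $$ (r, c) else 0)" for j
  have "F \<subseteq> (\<lambda>(r, c). gap r c) ` ({..<2 * n} \<times> {..<2 * n})" by (auto simp: F_def)
  then have F: "finite F" by (rule finite_subset) simp
  have eig: "Y j \<in> ad_eigenspace n (torus_elt n a) j" for j
    unfolding mem_ad_eigenspace_iff mem_sp_algC_iff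
  proof (intro conjI allI impI)
    fix r c assume rc: "r < 2 * n" "c < 2 * n"
    have "gap (dual_idx n c) (dual_idx n r) = gap r c"
      using rc by (simp add: gap_def diag_entry_dual_idx)
    then show "Y j $$ (dual_idx n c, dual_idx n r) = - idx_sign n r * idx_sign n c * Y j $$ (r, c)"
      using rc X by (simp add: Y_def mem_sp_algC_iff)
    assume "Y j $$ (r, c) \<noteq> 0"
    then have "gap r c = j" using rc by (auto simp: Y_def split: if_splits)
    then show "diag_entry n a r - diag_entry n a c = of_int j" using gap[OF rc] by simp
  qed (simp add: Y_def)
  have Y_carr: "\<And>j. j \<in> F \<Longrightarrow> Y j \<in> carrier_mat (2 * n) (2 * n)" by (simp add: Y_def)
  have sum_carr: "finsum (module_mat TYPE(complex) (2 * n) (2 * n)) Y F \<in> carrier_mat (2 * n) (2 * n)"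
    by (rule finsum_mat_carrier[OF F Y_carr])
  have "X = finsum (module_mat TYPE(complex) (2 * n) (2 * n)) Y F"
  proof (rule eq_matI)
    fix r c
    assume "r < dim_row (finsum (module_mat TYPE(complex) (2 * n) (2 * n)) Y F)"
      "c < dim_col (finsum (module_mat TYPE(complex) (2 * n) (2 * n)) Y F)"
    then have rc: "r < 2 * n" "c < 2 * n" using sum_carr by auto
    have "(\<Sum>j\<in>F. Y j $$ (r, c)) = (if gap r c \<in> F then X $$ (r, c) else 0)"
      using rc F by (simp add: Y_def)
    also have "\<dots> = X $$ (r, c)"
    proof (cases "X $$ (r, c) = 0")
      case False
      then have "gap r c \<le> i" using bounded rc gap[OF rc] by (metis of_int_le_iff)
      then show ?thesis using rc by (auto simp: F_def)
    qed simp
    finally show "X $$ (r, c) = finsum (module_mat TYPE(complex) (2 * n) (2 * n)) Y F $$ (r, c)"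
      using finsum_mat_index[OF F, of Y, OF Y_carr rc] by simp
  qed (use carr sum_carr in auto)
  moreover have "F \<subseteq> {..i}" by (auto simp: F_def)
  ultimately show "X \<in> parab n (torus_elt n a) i"
    unfolding parab_def using F eig by blast
qed

text \<open>
  Only the steps \<open>i \<ge> 0\<close> of the filtration enter the order, so an entry of
  negative degree may have its degree raised as long as it stays nonpositive.
\<close>
lemma prec_torus_eltI:
  assumes "\<forall>i<n. a i \<in> \<int>" "\<forall>i<n. b i \<in> \<int>"
    and "\<And>r c. r < 2 * n \<Longrightarrow> c < 2 * n \<Longrightarrow>
      diag_entry n b r - diag_entry n b c \<le> max 0 (diag_entry n a r - diag_entry n a c)"
  shows "prec n (torus_elt n a) (torus_elt n b)"
  unfolding prec_def subset_iff mem_parab_iff[OF assms(1)] mem_parab_iff[OF assms(2)]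
proof (intro allI impI conjI)
  fix i :: int and X r c
  assume i: "0 \<le> i" and X: "X \<in> sp_algC n \<and> (\<forall>r<2 * n. \<forall>c<2 * n. X $$ (r, c) \<noteq> 0 \<longrightarrow>
      diag_entry n a r - diag_entry n a c \<le> of_int i)"
    and rc: "r < 2 * n" "c < 2 * n" and nz: "X $$ (r, c) \<noteq> 0"
  have "diag_entry n a r - diag_entry n a c \<le> of_int i" using X rc nz by blast
  moreover have "(0 :: real) \<le> of_int i" using i by simp
  ultimately show "diag_entry n b r - diag_entry n b c \<le> of_int i"
    using assms(3)[OF rc] by linarith
qed blast

section \<open>Symmetric canonical elements have no gaps\<close>

lemma int_lattice_dom_torus_elt_iff:
  "torus_elt n a \<in> int_lattice_dom n \<longleftrightarrow>
     (\<forall>i<n. a i \<in> \<int> \<and> 0 \<le> a i) \<and> (\<forall>i j. i \<le> j \<longrightarrow> j < n \<longrightarrow> a j \<le> a i)"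
proof -
  have image_ball: "(\<forall>\<alpha>\<in>{f i j |i j. P i j}. Q \<alpha>) \<longleftrightarrow> (\<forall>i j. P i j \<longrightarrow> Q (f i j))"
    for f :: "nat \<Rightarrow> nat \<Rightarrow> complex mat \<Rightarrow> complex" and P Q by blast
  have "(\<forall>\<alpha>\<in>pos_roots n. 0 \<le> Re (\<alpha> (torus_elt n a) / \<i>)) \<longleftrightarrow>
      (\<forall>i j. i \<le> j \<longrightarrow> j < n \<longrightarrow> 0 \<le> Re ((L i (torus_elt n a) + L j (torus_elt n a)) / \<i>)) \<and>
      (\<forall>i j. i < j \<longrightarrow> j < n \<longrightarrow> 0 \<le> Re ((L i (torus_elt n a) - L j (torus_elt n a)) / \<i>))"
    unfolding pos_roots_def ball_Un image_ball by (simp only: imp_conjL)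
  also have "\<dots> \<longleftrightarrow> (\<forall>i j. i \<le> j \<longrightarrow> j < n \<longrightarrow> 0 \<le> a i + a j) \<and>
      (\<forall>i j. i < j \<longrightarrow> j < n \<longrightarrow> 0 \<le> a i - a j)"
    by (simp add: L_torus_elt add.commute cong: imp_cong)
  also have "\<dots> \<longleftrightarrow> (\<forall>i<n. 0 \<le> a i) \<and> (\<forall>i j. i \<le> j \<longrightarrow> j < n \<longrightarrow> a j \<le> a i)"
  proof (intro iffI conjI allI impI; (elim conjE)?)
    fix i assume *: "\<forall>i j. i \<le> j \<longrightarrow> j < n \<longrightarrow> 0 \<le> a i + a j" and "i < n"
    then show "0 \<le> a i" using *[rule_format, of i i] by simp
  next
    fix i j assume *: "\<forall>i j. i < j \<longrightarrow> j < n \<longrightarrow> 0 \<le> a i - a j" and "i \<le> j" "j < n"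
    then show "a j \<le> a i" using *[rule_format, of i j] by (cases "i = j") auto
  next
    fix i j assume "\<forall>i<n. 0 \<le> a i" "i \<le> j" "j < n"
    then show "0 \<le> a i + a j" by (simp add: add_nonneg_nonneg)
  next
    fix i j assume "\<forall>i j. i \<le> j \<longrightarrow> j < n \<longrightarrow> a j \<le> a i" "i < j" "j < n"
    then show "0 \<le> a i - a j" by simp
  qed
  finally show ?thesis
    unfolding int_lattice_dom_def by (auto simp: torus_elt_in_int_lattice_iff)
qed

lemma torus_elt_eq_iff: "torus_elt n a = torus_elt n b \<longleftrightarrow> (\<forall>i<n. a i = b i)"
proof
  assume eq: "torus_elt n a = torus_elt n b"
  show "\<forall>i<n. a i = b i"
  proof (intro allI impI)
    fix i assume i: "i < n"
    have "torus_elt n a $$ (i, i) = torus_elt n b $$ (i, i)" by (simp add: eq)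
    with i show "a i = b i" by (simp add: diag_entry_def)
  qed
next
  assume "\<forall>i<n. a i = b i"
  then have "diag_entry n a r = diag_entry n b r" if "r < 2 * n" for r
    using that by (simp add: diag_entry_def)
  then show "torus_elt n a = torus_elt n b" by (intro eq_matI) (auto simp: torus_elt_eq_mat_diag mat_diag_def)
qed

lemma int_lattice_dom_cases:
  assumes "\<xi> \<in> int_lattice_dom n"
  obtains h :: "nat \<Rightarrow> nat" where "\<xi> = torus_elt n (\<lambda>i. real (h i))"
    and "\<And>i j. i \<le> j \<Longrightarrow> j < n \<Longrightarrow> h j \<le> h i"
proof -
  have "\<xi> \<in> torus n" using assms by (simp add: int_lattice_dom_def int_lattice_def)
  then obtain a where a: "\<xi> = torus_elt n a" by (auto simp: torus_def)
  have dom: "\<forall>i<n. a i \<in> \<int> \<and> 0 \<le> a i" "\<And>i j. i \<le> j \<Longrightarrow> j < n \<Longrightarrow> a j \<le> a i"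
    using assms unfolding a int_lattice_dom_torus_elt_iff by blast+
  define h where "h i = nat \<lfloor>a i\<rfloor>" for i
  have h: "real (h i) = a i" if "i < n" for i
    using dom(1) that by (auto simp: h_def elim!: Ints_cases)
  show thesis
  proof (rule that[of h])
    show "\<xi> = torus_elt n (\<lambda>i. real (h i))" by (simp add: a torus_elt_eq_iff h)
    show "h j \<le> h i" if "i \<le> j" "j < n" for i j
      using dom(2)[OF that] by (auto simp: h_def intro: nat_mono floor_mono)
  qed
qed

text \<open>
  The odd extension of the map that subtracts \<open>2\<close> above \<open>t\<close>. Oddness
  makes it act on all diagonal entries \<open>\<plusminus>a\<^sub>i\<close> of a torus element at
  once.
\<close>
definition lower_above :: "real \<Rightarrow> real \<Rightarrow> real" where
  "lower_above t x = (if x > t then x - 2 else if x < - t then x + 2 else x)"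

text \<open>
  Away from the band between \<open>t\<close> and \<open>t + 2\<close>, the map is monotone and
  does not increase distances.
\<close>
lemma lower_above_diff_le:
  assumes "0 \<le> t" "\<bar>x\<bar> \<le> t \<or> t + 2 \<le> \<bar>x\<bar>" "\<bar>y\<bar> \<le> t \<or> t + 2 \<le> \<bar>y\<bar>"
  shows "lower_above t x - lower_above t y \<le> max 0 (x - y)"
proof -
  have "x \<le> - t - 2 \<or> (- t \<le> x \<and> x \<le> t) \<or> t + 2 \<le> x"
    "y \<le> - t - 2 \<or> (- t \<le> y \<and> y \<le> t) \<or> t + 2 \<le> y"
    using assms by linarith+
  then show ?thesis
    using assms(1) by (elim disjE) (auto simp: lower_above_def max_def)
qed

text \<open>
  If \<open>t + 1\<close> is skipped, lowering every entry above \<open>t\<close> by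
  \<open>2\<close> gives an element that is larger in the order, differs from the original by an
  even sequence, and is still dominant; by maximality nothing can have been lowered.
\<close>
lemma symmetric_canonical_attains:
  assumes can: "symmetric_canonical n (torus_elt n (\<lambda>i. real (h i)))"
    and anti: "\<And>i j. i \<le> j \<Longrightarrow> j < n \<Longrightarrow> h j \<le> h i"
    and i: "i < n" and t: "t < h i"
  shows "\<exists>j<n. h j = Suc t"
proof (rule ccontr)
  assume "\<not> ?thesis"
  then have skip: "h j \<le> t \<or> t + 2 \<le> h j" if "j < n" for j
    using that by (metis Suc_eq_plus1 add_2_eq_Suc' not_less_eq_eq le_antisym)
  define a where "a j = real (h j)" for j
  define b where "b j = lower_above (real t) (a j)" for j
  have skip_diag: "\<bar>diag_entry n a r\<bar> \<le> real t \<or> real t + 2 \<le> \<bar>diag_entry n a r\<bar>" if "r < 2 * n" for r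
  proof -
    define j where "j = (if r < n then r else r - n)"
    have "j < n" "\<bar>diag_entry n a r\<bar> = real (h j)"
      using that by (auto simp: j_def diag_entry_def a_def)
    with skip[of j] show ?thesis by linarith
  qed
  have diag_b: "diag_entry n b r = lower_above (real t) (diag_entry n a r)" for r
    by (auto simp: diag_entry_def b_def lower_above_def)
  have b_eq: "b j = (if t < h j then a j - 2 else a j)" for j
    by (auto simp: b_def a_def lower_above_def)
  have a_int: "\<forall>i<n. a i \<in> \<int>" by (simp add: a_def)
  then have b_int: "\<forall>i<n. b i \<in> \<int>" by (simp add: b_eq)
  have dom: "torus_elt n b \<in> int_lattice_dom n"
    unfolding int_lattice_dom_torus_elt_iff
  proof (intro conjI allI impI)
    fix j assume j: "j < n"
    show "b j \<in> \<int>" using b_int j by blast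
    show "0 \<le> b j" using skip[OF j] by (auto simp: b_eq a_def)
  next
    fix j k assume jk: "j \<le> k" "k < n"
    show "b k \<le> b j"
      using anti[OF jk] skip[of j] skip[of k] jk by (auto simp: b_eq a_def)
  qed
  have "prec n (torus_elt n a) (torus_elt n b)"
  proof (rule prec_torus_eltI[OF a_int b_int])
    fix r c assume "r < 2 * n" "c < 2 * n"
    then show "diag_entry n b r - diag_entry n b c \<le> max 0 (diag_entry n a r - diag_entry n a c)"
      unfolding diag_b by (intro lower_above_diff_le skip_diag) simp_all
  qed
  moreover have "torus_elt n a - torus_elt n b = torus_elt n (\<lambda>j. a j - b j)"
    by (rule eq_matI) (auto simp: torus_elt_def algebra_simps)
  then have "torus_elt n a - torus_elt n b \<in> int_lattice2 n"
    by (simp add: torus_elt_in_int_lattice2_iff b_eq)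
  ultimately have "prec_I n (torus_elt n a) (torus_elt n b)"
    by (simp add: prec_I_def)
  with can dom have "torus_elt n b = torus_elt n a"
    by (simp add: symmetric_canonical_def a_def[abs_def])
  then show False
    using i t by (auto simp: torus_elt_eq_iff b_eq split: if_splits)
qed

text \<open>
  All of \<open>1, \<dots>, h i\<close> must be attained at indices from \<open>i\<close> on, by
  monotonicity.
\<close>
lemma gap_free_le_index:
  fixes h :: "nat \<Rightarrow> nat"
  assumes anti: "\<And>i j. i \<le> j \<Longrightarrow> j < n \<Longrightarrow> h j \<le> h i"
    and attains: "\<And>i t. i < n \<Longrightarrow> t < h i \<Longrightarrow> \<exists>j<n. h j = Suc t"
    and i: "i < n"
  shows "h i \<le> n - i"
proof -
  have "{1..h i} \<subseteq> h ` {i..<n}"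
  proof
    fix v assume v: "v \<in> {1..h i}"
    show "v \<in> h ` {i..<n}"
    proof (cases "v = h i")
      case False
      have "v - 1 < h i" "Suc (v - 1) = v" using v by auto
      then obtain j where j: "j < n" "h j = v" using attains[OF i] by metis
      have "i \<le> j" using anti[of j i] i j v False by (cases "i \<le> j") auto
      with j show ?thesis by auto
    qed (use i in auto)
  qed
  then have "card {1..h i} \<le> card {i..<n}" by (rule surj_card_le[OF finite_atLeastLessThan])
  then show ?thesis by simp
qed

text \<open>
  There are \<open>(h i + 1) div 2\<close> odd numbers up to \<open>h i\<close>, each attained at
  a different index.
\<close>
lemma gap_free_le_twice_odd:
  fixes h :: "nat \<Rightarrow> nat"
  assumes attains: "\<And>i t. i < n \<Longrightarrow> t < h i \<Longrightarrow> \<exists>j<n. h j = Suc t"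
    and i: "i < n"
  shows "h i \<le> 2 * card {j. j < n \<and> odd (h j)}"
proof -
  have "(\<lambda>s. 2 * s + 1) ` {..<(h i + 1) div 2} \<subseteq> h ` {j. j < n \<and> odd (h j)}"
  proof (rule image_subsetI)
    fix s assume s: "s \<in> {..<(h i + 1) div 2}"
    then have "2 * s < h i" by auto
    then obtain j where "j < n" "h j = Suc (2 * s)" using attains[OF i] by blast
    then show "2 * s + 1 \<in> h ` {j. j < n \<and> odd (h j)}" by (intro image_eqI[of _ _ j]) auto
  qed
  then have "card ((\<lambda>s. 2 * s + 1) ` {..<(h i + 1) div 2}) \<le> card {j. j < n \<and> odd (h j)}"
    by (intro surj_card_le) auto
  then have "(h i + 1) div 2 \<le> card {j. j < n \<and> odd (h j)}"
    by (simp add: card_image inj_on_def)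
  then show ?thesis by linarith
qed

section \<open>Coordinate subspaces and their orthogonal projections\<close>

definition coord_subspace :: "nat \<Rightarrow> nat set \<Rightarrow> complex vec set" where
  "coord_subspace d S = {v \<in> carrier_vec d. \<forall>r<d. r \<notin> S \<longrightarrow> v $ r = 0}"

context
  fixes d :: nat and S :: "nat set"
  assumes S: "S \<subseteq> {..<d}"
begin

interpretation V: vec_space "TYPE(complex)" d .

lemma unit_vec_inj_on: "inj_on (unit_vec d :: nat \<Rightarrow> complex vec) S"
  using S by (auto simp: inj_on_def unit_vec_eq)

lemma span_unit_vecs: "V.span (unit_vec d ` S) = coord_subspace d S"
proof
  let ?U = "unit_vec d ` S :: complex vec set"
  have units: "?U \<subseteq> carrier_vec d" by auto
  show "V.span (?U) \<subseteq> coord_subspace d S"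
  proof
    fix v assume v: "v \<in> V.span (?U)"
    then obtain a A where A: "v = V.lincomb a A" "finite A" "A \<subseteq> ?U"
      by (blast dest: V.in_spanE)
    have "v $ r = 0" if r: "r < d" "r \<notin> S" for r
    proof -
      have "v $ r = (\<Sum>x\<in>A. a x * x $ r)"
        unfolding A(1) using A(3) units r(1) by (intro V.lincomb_index) auto
      also have "\<dots> = 0"
      proof (intro sum.neutral ballI)
        fix x assume "x \<in> A"
        then obtain s where "s \<in> S" "x = unit_vec d s" using A(3) by blast
        then show "a x * x $ r = 0" using r by (auto simp: unit_vec_def)
      qed
      finally show ?thesis .
    qed
    moreover have "v \<in> carrier_vec d" using v V.span_closed[OF units] by auto
    ultimately show "v \<in> coord_subspace d S" by (simp add: coord_subspace_def)
  qed
  show "coord_subspace d S \<subseteq> V.span (?U)"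
  proof
    fix v assume "v \<in> coord_subspace d S"
    then have v: "v \<in> carrier_vec d" "\<And>r. r < d \<Longrightarrow> r \<notin> S \<Longrightarrow> v $ r = 0"
      by (auto simp: coord_subspace_def)
    let ?a = "\<lambda>u :: complex vec. v $ (THE i. i \<in> S \<and> u = unit_vec d i)"
    have a: "?a (unit_vec d s) = v $ s" if "s \<in> S" for s
      using that unit_vec_inj_on by (intro arg_cong[of _ _ "($) v"] the_equality) (auto simp: inj_on_def)
    have finS: "finite S" using S finite_subset by blast
    have "V.lincomb ?a (?U) = v"
    proof (rule eq_vecI)
      fix r assume "r < dim_vec v"
      then have r: "r < d" using v by auto
      have "V.lincomb ?a (?U) $ r = (\<Sum>x\<in>?U. ?a x * x $ r)"
        using r units by (rule V.lincomb_index)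
      also have "\<dots> = (\<Sum>s\<in>S. v $ s * unit_vec d s $ r)"
        by (simp add: sum.reindex[OF unit_vec_inj_on] a)
      also have "\<dots> = (\<Sum>s\<in>S. if s = r then v $ s else 0)"
        using r S by (intro sum.cong) (auto simp: unit_vec_def subset_iff)
      also have "\<dots> = v $ r" using v(2)[OF r] finS by auto
      finally show "V.lincomb ?a (?U) $ r = v $ r" .
    qed (use v units finS in \<open>simp add: V.lincomb_dim\<close>)
    then show "v \<in> V.span (?U)"
      using finS by (intro V.in_spanI[of v ?a "?U"]) auto
  qed
qed

lemma coord_subspace_is_subspace: "csubspace_of (coord_subspace d S) d"
proof -
  let ?U = "unit_vec d ` S :: complex vec set"
  have "?U \<subseteq> carrier_vec d" by auto
  from V.span_is_subspace[OF this] show ?thesis by (simp add: span_unit_vecs)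
qed

lemma dim_coord_subspace:
  "vectorspace.dim class_ring ((module_vec TYPE(complex) d)\<lparr>carrier := coord_subspace d S\<rparr>) = card S"
proof -
  let ?U = "unit_vec d ` S :: complex vec set"
  have "?U \<subseteq> set (unit_vecs d)" using S by (auto simp: unit_vecs_def)
  then have "V.lin_indpt (?U)"
    using V.unit_vecs_basis V.subset_li_is_li by (auto simp: V.basis_def)
  moreover have sub: "submodule class_ring (coord_subspace d S) V.V"
    using coord_subspace_is_subspace by (simp add: VectorSpace.subspace_def)
  interpret W: vectorspace class_ring "V.vs (coord_subspace d S)"
    by (rule V.subspace_is_vs[OF coord_subspace_is_subspace])
  have units: "?U \<subseteq> coord_subspace d S"
    by (auto simp: coord_subspace_def unit_vec_def)
  ultimately have "W.basis (?U)"
    unfolding W.basis_def V.span_li_not_depend[OF units sub] by (simp add: units span_unit_vecs)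
  moreover have "finite (?U)" using S finite_subset by blast
  ultimately have "W.dim = card (?U)" by (intro W.dim_basis)
  then show ?thesis by (simp add: span_unit_vecs card_image[OF unit_vec_inj_on])
qed

end

text \<open>
  Two candidates for the projection of \<open>v\<close> differ by a vector that lies in
  \<open>V\<close> and is orthogonal to \<open>V\<close>, hence vanishes.
\<close>
lemma orth_proj_unique:
  assumes V: "csubspace_of V d"
    and P: "P \<in> carrier_mat d d" "\<And>v. v \<in> carrier_vec d \<Longrightarrow>
      P *\<^sub>v v \<in> V \<and> (\<forall>w\<in>V. (v - P *\<^sub>v v) \<bullet>c w = 0)"
  shows "orth_proj d V = P"
  unfolding orth_proj_def
proof (rule the_equality)
  show "P \<in> carrier_mat d d \<and> (\<forall>v\<in>carrier_vec d. P *\<^sub>v v \<in> V \<and> (\<forall>w\<in>V. (v - P *\<^sub>v v) \<bullet>c w = 0))"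
    using P by blast
  fix Q assume Q: "Q \<in> carrier_mat d d \<and>
    (\<forall>v\<in>carrier_vec d. Q *\<^sub>v v \<in> V \<and> (\<forall>w\<in>V. (v - Q *\<^sub>v v) \<bullet>c w = 0))"
  interpret U: submodule class_ring V "module_vec TYPE(complex) d"
    using V by (simp add: VectorSpace.subspace_def)
  have sub: "V \<subseteq> carrier_vec d" using U.subset by (simp add: module_vec_simps)
  have "Q *\<^sub>v v = P *\<^sub>v v" if v: "v \<in> carrier_vec d" for v
  proof -
    have mem: "Q *\<^sub>v v \<in> V" "P *\<^sub>v v \<in> V"
      and orth: "\<And>w. w \<in> V \<Longrightarrow> (v - Q *\<^sub>v v) \<bullet>c w = 0" "\<And>w. w \<in> V \<Longrightarrow> (v - P *\<^sub>v v) \<bullet>c w = 0"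
      using P Q v by blast+
    define x y where "x = Q *\<^sub>v v" and "y = P *\<^sub>v v"
    have xy: "x \<in> carrier_vec d" "y \<in> carrier_vec d" using mem sub by (auto simp: x_def y_def)
    have "(-1) \<cdot>\<^sub>v y \<in> V" using U.smult_closed[of "-1" y] mem by (simp add: y_def module_vec_simps)
    then have "x + (-1) \<cdot>\<^sub>v y \<in> V"
      using U.m_closed[of x "(-1) \<cdot>\<^sub>v y"] mem by (simp add: x_def module_vec_simps)
    moreover have eq: "x + (-1) \<cdot>\<^sub>v y = x - y" using xy by (intro eq_vecI) auto
    ultimately have w: "x - y \<in> V" by simp
    then have wc: "conjugate (x - y) \<in> carrier_vec d" using sub by auto
    have "(v - y) \<bullet>c (x - y) = 0" "(v - x) \<bullet>c (x - y) = 0"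
      using orth w by (auto simp: x_def y_def)
    then have "((v - y) - (v - x)) \<bullet>c (x - y) = 0"
      using v xy wc by (subst minus_scalar_prod_distrib[of _ d]) auto
    moreover have "(v - y) - (v - x) = x - y" using v xy by (intro eq_vecI) auto
    ultimately have "(x - y) \<bullet>c (x - y) = 0" by simp
    then have "x - y = 0\<^sub>v d" using xy by (subst (asm) conjugate_square_eq_0_vec[of _ d]) auto
    then show ?thesis using xy unfolding x_def[symmetric] y_def[symmetric]
      by (auto simp: vec_eq_iff)
  qed
  moreover have "X $$ (i, j) = (X *\<^sub>v unit_vec d j) $ i"
    if "X \<in> carrier_mat d d" "i < d" "j < d" for X :: "complex mat" and i j
    using that by (simp add: unit_vec_def mult_mat_vec_index_sum if_distrib cong: if_cong
        del: index_mult_mat_vec)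
  ultimately have "Q $$ (i, j) = P $$ (i, j)" if "i < d" "j < d" for i j
    using P(1) Q that by (metis unit_vec_carrier)
  then show "Q = P" using P(1) Q by (intro eq_matI) auto
qed

section \<open>The parity count from traces\<close>

definition mat_trace :: "complex mat \<Rightarrow> complex" where
  "mat_trace A = (\<Sum>i<dim_row A. A $$ (i, i))"

lemma mat_trace_mult_commute:
  assumes "A \<in> carrier_mat d e" "B \<in> carrier_mat e d"
  shows "mat_trace (A * B) = mat_trace (B * A)"
proof -
  have "mat_trace (A * B) = (\<Sum>i<d. \<Sum>j<e. A $$ (i, j) * B $$ (j, i))"
    using assms by (auto simp: mat_trace_def scalar_prod_def atLeast0LessThan)
  also have "\<dots> = (\<Sum>j<e. \<Sum>i<d. B $$ (j, i) * A $$ (i, j))"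
    by (subst sum.swap) (simp add: mult.commute)
  also have "\<dots> = mat_trace (B * A)"
    using assms by (auto simp: mat_trace_def scalar_prod_def atLeast0LessThan)
  finally show ?thesis .
qed

lemma mat_trace_mat_diag: "mat_trace (mat_diag d f) = (\<Sum>i<d. f i)"
  by (simp add: mat_trace_def mat_diag_def)

lemma sum_double: "(\<Sum>r<2 * n. f r) = (\<Sum>i<n. f i + f (n + i))" for f :: "nat \<Rightarrow> 'a :: comm_monoid_add"
proof -
  have "(\<Sum>r<2 * n. f r) = (\<Sum>r\<in>{..<n} \<union> {n..<2 * n}. f r)" by (rule sum.cong) auto
  also have "\<dots> = (\<Sum>r<n. f r) + (\<Sum>r\<in>{n..<2 * n}. f r)" by (rule sum.union_disjoint) auto
  also have "(\<Sum>r\<in>{n..<2 * n}. f r) = (\<Sum>i<n. f (n + i))"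
    by (rule sum.reindex_bij_witness[of _ "\<lambda>i. n + i" "\<lambda>r. r - n"]) auto
  finally show ?thesis by (simp add: sum.distrib)
qed

text \<open>
  The span of \<open>e\<^sub>1, \<dots>, e\<^sub>m\<close> and their images under
  \<open>J\<close>: the point of the Grassmannian at which the trace is evaluated.
\<close>
lemma coord_subspace_in_quat_grass:
  assumes "m \<le> n"
  shows "coord_subspace (2 * n) ({..<m} \<union> {n..<n + m}) \<in> quat_grass m n"
proof -
  let ?S = "{..<m} \<union> {n..<n + m}"
  have S: "?S \<subseteq> {..<2 * n}" using assms by auto
  have "card ?S = 2 * m" using assms by (subst card_Un_disjoint) auto
  moreover have "quatJ n v \<in> coord_subspace (2 * n) ?S" if v: "v \<in> coord_subspace (2 * n) ?S" for v
  proof -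
    have "quatJ n v $ r = 0" if r: "r < 2 * n" "r \<notin> ?S" for r
    proof -
      have "dual_idx n r \<notin> ?S" using r assms by (auto simp: dual_idx_def)
      then have "v $ dual_idx n r = 0" using v r by (simp add: coord_subspace_def)
      then show ?thesis using r by (simp add: quatJ_index)
    qed
    then show ?thesis by (simp add: coord_subspace_def)
  qed
  ultimately show ?thesis
    using coord_subspace_is_subspace[OF S] dim_coord_subspace[OF S] by (simp add: quat_grass_def)
qed

lemma iota_coord_subspace:
  assumes S: "S \<subseteq> {..<2 * n}"
  shows "iota n (coord_subspace (2 * n) S) = mat_diag (2 * n) (\<lambda>r. if r \<in> S then - 1 else 1)"
proof -
  let ?P = "mat_diag (2 * n) (\<lambda>r. if r \<in> S then 1 else 0) :: complex mat"
  have app: "?P *\<^sub>v v = vec (2 * n) (\<lambda>r. if r \<in> S then v $ r else 0)"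
    if "v \<in> carrier_vec (2 * n)" for v
  proof (rule eq_vecI)
    fix r assume "r < dim_vec (vec (2 * n) (\<lambda>r. if r \<in> S then v $ r else 0))"
    then have r: "r < 2 * n" by simp
    have "(?P *\<^sub>v v) $ r = (\<Sum>c<2 * n. ?P $$ (r, c) * v $ c)"
      by (rule mult_mat_vec_index_sum[OF mat_diag_dim that r])
    also have "\<dots> = (\<Sum>c<2 * n. if c = r then if r \<in> S then v $ r else 0 else 0)"
      using r by (intro sum.cong) (auto simp: mat_diag_def)
    finally show "(?P *\<^sub>v v) $ r = vec (2 * n) (\<lambda>r. if r \<in> S then v $ r else 0) $ r"
      using r by simp
  qed (simp add: mat_diag_def)
  have "orth_proj (2 * n) (coord_subspace (2 * n) S) = ?P"
  proof (rule orth_proj_unique[OF coord_subspace_is_subspace[OF S]])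
    fix v :: "complex vec" assume v: "v \<in> carrier_vec (2 * n)"
    show "?P *\<^sub>v v \<in> coord_subspace (2 * n) S \<and>
      (\<forall>w\<in>coord_subspace (2 * n) S. (v - ?P *\<^sub>v v) \<bullet>c w = 0)"
      unfolding app[OF v]
    proof (intro conjI ballI)
      fix w assume "w \<in> coord_subspace (2 * n) S"
      then show "(v - vec (2 * n) (\<lambda>r. if r \<in> S then v $ r else 0)) \<bullet>c w = 0"
        using v by (auto simp: scalar_prod_def coord_subspace_def intro!: sum.neutral)
    qed (auto simp: coord_subspace_def)
  qed simp
  then show ?thesis
    by (intro eq_matI) (auto simp: iota_def mat_diag_def)
qed

lemma gamma_minus_one:
  "gamma (torus_elt n (\<lambda>i. real (h i))) (-1)
     = mat_diag (2 * n) (\<lambda>r. (-1) ^ h (if r < n then r else r - n))"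
proof -
  have pi: "exp (\<i> * of_real pi * of_nat k) = (-1) ^ k" for k :: nat
  proof -
    have "exp (\<i> * of_real pi * of_nat k) = exp (of_nat k * (\<i> * of_real pi))"
      by (simp only: mult.commute)
    then show ?thesis by (simp only: exp_of_nat_mult exp_pi_i')
  qed
  have minus_pi: "exp (- (\<i> * of_real pi * of_nat k)) = (-1) ^ k" for k :: nat
    by (cases "even k") (simp_all add: exp_minus pi)
  have "- \<i> * Ln (-1) = complex_of_real pi" by (simp add: Ln_minus1)
  then have "gamma (torus_elt n (\<lambda>i. real (h i))) (-1) = mat_diag (2 * n)
      (\<lambda>r. exp (of_real pi * \<i> * of_real (diag_entry n (\<lambda>i. real (h i)) r)))"
    unfolding gamma_def by (simp only: mat_exp_smult_torus_elt)
  also have "\<dots> = mat_diag (2 * n) (\<lambda>r. (-1) ^ h (if r < n then r else r - n))"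
  proof (rule arg_cong[of _ _ "mat_diag (2 * n)"], rule ext)
    fix r
    have "of_real pi * \<i> * of_real (diag_entry n (\<lambda>i. real (h i)) r)
        = (if r < n then \<i> * of_real pi * of_nat (h r) else - (\<i> * of_real pi * of_nat (h (r - n))))"
      by (simp add: diag_entry_def)
    then show "exp (of_real pi * \<i> * of_real (diag_entry n (\<lambda>i. real (h i)) r))
        = (-1) ^ h (if r < n then r else r - n)"
      by (simp only: if_distrib[of exp] pi minus_pi) simp
  qed
  finally show ?thesis .
qed

lemma mat_trace_unitary_conj:
  assumes "g \<in> Sp n" "D \<in> carrier_mat (2 * n) (2 * n)"
  shows "mat_trace (g * D * mat_adjoint g) = mat_trace D"
proof -
  have g: "g \<in> carrier_mat (2 * n) (2 * n)" "mat_adjoint g * g = 1\<^sub>m (2 * n)"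
    using assms by (auto simp: Sp_def)
  have adj: "mat_adjoint g \<in> carrier_mat (2 * n) (2 * n)"
    using g by (auto simp: mat_adjoint_index)
  have "mat_trace (g * D * mat_adjoint g) = mat_trace (g * (D * mat_adjoint g))"
    using g adj assms by (simp add: assoc_mult_mat[of _ _ "2 * n" _ "2 * n" _ "2 * n"])
  also have "\<dots> = mat_trace (D * mat_adjoint g * g)"
    using g adj assms by (intro mat_trace_mult_commute[of _ "2 * n" "2 * n"]) auto
  also have "D * mat_adjoint g * g = D"
    using g adj assms by (simp add: assoc_mult_mat[of _ _ "2 * n" _ "2 * n" _ "2 * n"])
  finally show ?thesis .
qed

text \<open>
  The trace is constant on a conjugacy class. It is \<open>2 (n - 2 m)\<close> on the image of the
  Grassmannian and \<open>2 (n - 2 q)\<close> at \<open>\<gamma>\<^sub>\<xi>(-1)\<close>, where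
  \<open>q\<close> is the number of odd coordinates.
\<close>
lemma card_odd_of_orbit:
  assumes "N_orbit n (torus_elt n (\<lambda>i. real (h i))) = iota n ` quat_grass m n" and "m \<le> n"
  shows "card {i. i < n \<and> odd (h i)} = m"
proof -
  let ?S = "{..<m} \<union> {n..<n + m}" and ?O = "{i. i < n \<and> odd (h i)}"
  let ?D = "gamma (torus_elt n (\<lambda>i. real (h i))) (-1)"
  have "iota n (coord_subspace (2 * n) ?S) \<in> N_orbit n (torus_elt n (\<lambda>i. real (h i)))"
    using assms coord_subspace_in_quat_grass by blast
  then obtain g where g: "g \<in> Sp n" "iota n (coord_subspace (2 * n) ?S) = g * ?D * mat_adjoint g"
    by (auto simp: N_orbit_def)
  have minus: "(\<Sum>i<n. if P i then - 1 else 1) = of_nat n - 2 * (of_nat (card {i. i < n \<and> P i}) :: complex)"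
    for P
  proof -
    have "(\<Sum>i<n. if P i then - 1 else 1 :: complex) = (\<Sum>i<n. 1 - 2 * (if P i then 1 else 0))"
      by (rule sum.cong) auto
    also have "\<dots> = of_nat n - 2 * (\<Sum>i<n. if P i then 1 else 0)"
      by (simp add: sum_subtractf sum_distrib_left)
    also have "(\<Sum>i<n. if P i then 1 else 0 :: complex) = of_nat (card {i. i < n \<and> P i})"
      by (simp add: sum.If_cases Int_def)
    finally show ?thesis .
  qed
  have "mat_trace (iota n (coord_subspace (2 * n) ?S)) = 2 * (\<Sum>i<n. if i < m then - 1 else 1)"
    using assms(2) by (subst iota_coord_subspace)
      (auto simp: mat_trace_mat_diag sum_double sum_distrib_left intro!: sum.cong)
  also have "{i. i < n \<and> i < m} = {..<m}" using assms(2) by auto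
  then have "(\<Sum>i<n. if i < m then - 1 else 1 :: complex) = of_nat n - 2 * of_nat m"
    by (simp add: minus)
  finally have left: "mat_trace (iota n (coord_subspace (2 * n) ?S)) = 2 * (of_nat n - 2 * of_nat m)" .
  have "mat_trace ?D = 2 * (\<Sum>i<n. if odd (h i) then - 1 else 1)"
    by (auto simp: gamma_minus_one mat_trace_mat_diag sum_double sum_distrib_left intro!: sum.cong)
  then have "mat_trace ?D = 2 * (of_nat n - 2 * of_nat (card ?O))" by (simp add: minus)
  moreover have "mat_trace (g * ?D * mat_adjoint g) = mat_trace ?D"
    unfolding gamma_minus_one by (rule mat_trace_unitary_conj[OF g(1) mat_diag_dim])
  ultimately have "(of_nat (card ?O) :: complex) = of_nat m"
    using left g(2) by simp
  then show ?thesis by (simp only: of_nat_eq_iff)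
qed

section \<open>Triples of type sl(2)\<close>

locale sl2_triple =
  fixes d :: nat and E F H :: "complex mat"
  assumes carr: "E \<in> carrier_mat d d" "F \<in> carrier_mat d d" "H \<in> carrier_mat d d"
    and EF: "bracket E F = H"
    and HE: "bracket H E = 2 \<cdot>\<^sub>m E"
    and HF: "bracket H F = (- 2) \<cdot>\<^sub>m F"

lemma mult_mat_zero_vec: "A \<in> carrier_mat nr nc \<Longrightarrow> A *\<^sub>v 0\<^sub>v nc = 0\<^sub>v nr"
  by (intro eq_vecI) auto

lemma smult_mult_mat_vec:
  fixes A :: "complex mat"
  assumes "A \<in> carrier_mat nr nc" "v \<in> carrier_vec nc"
  shows "(k \<cdot>\<^sub>m A) *\<^sub>v v = k \<cdot>\<^sub>v (A *\<^sub>v v)"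
  using assms by (intro eq_vecI)
    (auto simp: mult_mat_vec_index_sum[of _ nr nc] sum_distrib_left mult.assoc simp del: index_mult_mat_vec)

lemma bracket_apply:
  assumes "A \<in> carrier_mat d d" "B \<in> carrier_mat d d" "v \<in> carrier_vec d"
  shows "A *\<^sub>v (B *\<^sub>v v) = B *\<^sub>v (A *\<^sub>v v) + bracket A B *\<^sub>v v"
proof -
  have carr: "A * B *\<^sub>v v \<in> carrier_vec d" "B * A *\<^sub>v v \<in> carrier_vec d"
    using assms by auto
  have "bracket A B *\<^sub>v v = A * B *\<^sub>v v - B * A *\<^sub>v v"
    unfolding bracket_def using assms
    by (intro minus_mult_distrib_mat_vec[of _ d d]) auto
  moreover have "x + (y - x) = y" if "x \<in> carrier_vec d" "y \<in> carrier_vec d" for x y :: "complex vec"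
    using that by (intro eq_vecI) auto
  ultimately have "B * A *\<^sub>v v + bracket A B *\<^sub>v v = A * B *\<^sub>v v"
    using carr by simp
  then show ?thesis using assms by (simp add: assoc_mult_mat_vec)
qed

lemma funpow_mult_mat_vec_carrier [simp]:
  "A \<in> carrier_mat d d \<Longrightarrow> v \<in> carrier_vec d \<Longrightarrow> (((*\<^sub>v) A) ^^ k) v \<in> carrier_vec d"
  by (induction k) auto

lemma funpow_mult_mat_vec_zero [simp]:
  "A \<in> carrier_mat d d \<Longrightarrow> (((*\<^sub>v) A) ^^ k) (0\<^sub>v d) = 0\<^sub>v d" for A :: "complex mat"
  by (induction k) auto

lemma eigen_shift:
  assumes carr: "A \<in> carrier_mat d d" "B \<in> carrier_mat d d" "v \<in> carrier_vec d"
    and shift: "bracket A B = t \<cdot>\<^sub>m B" and eig: "A *\<^sub>v v = p \<cdot>\<^sub>v v"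
  shows "A *\<^sub>v (((*\<^sub>v) B) ^^ k) v = (p + of_nat k * t) \<cdot>\<^sub>v (((*\<^sub>v) B) ^^ k) v"
proof (induction k)
  case 0
  then show ?case using eig by simp
next
  case (Suc k)
  let ?u = "(((*\<^sub>v) B) ^^ k) v"
  have u: "?u \<in> carrier_vec d" using carr by simp
  have "A *\<^sub>v (B *\<^sub>v ?u) = B *\<^sub>v ((p + of_nat k * t) \<cdot>\<^sub>v ?u) + (t \<cdot>\<^sub>m B) *\<^sub>v ?u"
    using bracket_apply[OF carr(1,2) u] by (simp add: Suc shift)
  also have "\<dots> = (p + of_nat k * t) \<cdot>\<^sub>v (B *\<^sub>v ?u) + t \<cdot>\<^sub>v (B *\<^sub>v ?u)"
    using carr u by (simp add: mult_mat_vec smult_mult_mat_vec)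
  also have "\<dots> = (p + of_nat (Suc k) * t) \<cdot>\<^sub>v (B *\<^sub>v ?u)"
    by (simp add: algebra_simps flip: add_smult_distrib_vec)
  finally show ?case by simp
qed

context sl2_triple
begin

text \<open>
  The standard commutation rule of \<open>E\<close> with powers of \<open>F\<close>. The first
  summand vanishes on a highest weight vector; on a general one it is what links the weights
  \<open>p\<close> and \<open>p + 2\<close>.
\<close>
lemma E_funpow_F:
  assumes v: "v \<in> carrier_vec d" and eig: "H *\<^sub>v v = p \<cdot>\<^sub>v v"
  shows "E *\<^sub>v (((*\<^sub>v) F) ^^ Suc k) v = (((*\<^sub>v) F) ^^ Suc k) (E *\<^sub>v v)
    + (of_nat (Suc k) * (p - of_nat k)) \<cdot>\<^sub>v (((*\<^sub>v) F) ^^ k) v"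
proof (induction k)
  case 0
  have "E *\<^sub>v (F *\<^sub>v v) = F *\<^sub>v (E *\<^sub>v v) + H *\<^sub>v v"
    using bracket_apply[OF carr(1,2) v] by (simp add: EF)
  then show ?case by (simp add: eig)
next
  case (Suc k)
  let ?F = "\<lambda>k. ((*\<^sub>v) F) ^^ k"
  let ?c = "of_nat (Suc k) * (p - of_nat k)"
  have carr': "?F k v \<in> carrier_vec d" for k using carr v by simp
  have carr'': "?F k (E *\<^sub>v v) \<in> carrier_vec d" for k using carr v by simp
  have "E *\<^sub>v ?F (Suc (Suc k)) v = F *\<^sub>v (E *\<^sub>v ?F (Suc k) v) + H *\<^sub>v ?F (Suc k) v"
    using bracket_apply[OF carr(1,2) carr'[of "Suc k"]] by (simp add: EF)
  also have "F *\<^sub>v (E *\<^sub>v ?F (Suc k) v) = F *\<^sub>v (?F (Suc k) (E *\<^sub>v v) + ?c \<cdot>\<^sub>v ?F k v)"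
    by (simp only: Suc.IH)
  also have "\<dots> = F *\<^sub>v ?F (Suc k) (E *\<^sub>v v) + ?c \<cdot>\<^sub>v (F *\<^sub>v ?F k v)"
    using carr carr'[of k] carr''[of "Suc k"]
    by (simp only: mult_add_distrib_mat_vec[OF carr(2) carr''] smult_carrier_vec
        mult_mat_vec[OF carr(2) carr'])
  also have "F *\<^sub>v ?F k v = ?F (Suc k) v" by simp
  also have "F *\<^sub>v ?F (Suc k) (E *\<^sub>v v) = ?F (Suc (Suc k)) (E *\<^sub>v v)" by simp
  also have "H *\<^sub>v ?F (Suc k) v = (p + of_nat (Suc k) * (- 2)) \<cdot>\<^sub>v ?F (Suc k) v"
    by (rule eigen_shift[OF carr(3,2) v HF eig])
  also have "?F (Suc (Suc k)) (E *\<^sub>v v) + ?c \<cdot>\<^sub>v ?F (Suc k) v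
      + (p + of_nat (Suc k) * (- 2)) \<cdot>\<^sub>v ?F (Suc k) v
      = ?F (Suc (Suc k)) (E *\<^sub>v v) + (?c + (p + of_nat (Suc k) * (- 2))) \<cdot>\<^sub>v ?F (Suc k) v"
    using carr'[of "Suc k"] carr''[of "Suc (Suc k)"]
    by (simp only: add_smult_distrib_vec)
      (rule assoc_add_vec[of _ d], auto simp del: funpow.simps)
  also have "?c + (p + of_nat (Suc k) * (- 2)) = of_nat (Suc (Suc k)) * (p - of_nat (Suc k))"
    by (simp add: algebra_simps)
  finally show ?case .
qed

text \<open>
  Otherwise the vectors \<open>E\<^sup>N v\<close> would be eigenvectors of \<open>H\<close> for
  infinitely many eigenvalues.
\<close>
lemma E_nilpotent_on_eigenvector:
  assumes v: "v \<in> carrier_vec d" and eig: "H *\<^sub>v v = p \<cdot>\<^sub>v v"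
  shows "\<exists>N. (((*\<^sub>v) E) ^^ N) v = 0\<^sub>v d"
proof (rule ccontr)
  assume nz: "\<not> ?thesis"
  have "poly (char_poly H) (p + of_nat N * 2) = 0" for N
    unfolding eigenvalue_root_char_poly[OF carr(3), symmetric] eigenvalue_def eigenvector_def
    using eigen_shift[OF carr(3,1) v HE eig, of N] nz carr v
    by (intro exI[of _ "(((*\<^sub>v) E) ^^ N) v"]) auto
  then have "range (\<lambda>N :: nat. p + of_nat N * 2) \<subseteq> {x. poly (char_poly H) x = 0}"
    by auto
  moreover have "char_poly H \<noteq> 0" using degree_monic_char_poly[OF carr(3)] by auto
  then have "finite {x. poly (char_poly H) x = 0}" by (rule poly_roots_finite)
  ultimately have "finite (range (\<lambda>N :: nat. p + of_nat N * 2))" by (rule finite_subset)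
  moreover have "inj (\<lambda>N :: nat. p + of_nat N * 2)" by (auto simp: inj_on_def)
  ultimately show False by (simp add: finite_image_iff)
qed

text \<open>
  This is injectivity of \<open>F\<^sup>p\<close> on the eigenspace of weight \<open>p\<close>,
  the fact behind the reflection symmetry of weights. A decomposition into irreducibles is avoided
  by proving more: no nonzero vector of weight \<open>p\<close> is killed by
  \<open>F\<^sup>s\<close> with \<open>s \<le> p\<close>. The outer induction is on the power of
  \<open>E\<close> that annihilates \<open>v\<close>. If \<open>F\<^bsup>s+1\<^esup> v = 0\<close>
  with \<open>s < p\<close>, the commutation rule shows that \<open>E v\<close>, of weight
  \<open>p + 2\<close>, is killed by \<open>F\<^bsup>s+2\<^esup>\<close>, so \<open>E v =
  0\<close>; the rule for one power less then gives \<open>F\<^sup>s v = 0\<close>, since its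
  coefficient \<open>(s + 1) (p - s)\<close> does not vanish.
\<close>
lemma F_power_nonzero:
  assumes v: "v \<in> carrier_vec d" "v \<noteq> 0\<^sub>v d" and eig: "H *\<^sub>v v = of_nat p \<cdot>\<^sub>v v"
  shows "(((*\<^sub>v) F) ^^ p) v \<noteq> 0\<^sub>v d"
proof -
  let ?E = "\<lambda>k. ((*\<^sub>v) E) ^^ k" and ?F = "\<lambda>k. ((*\<^sub>v) F) ^^ k"
  have claim: "v = 0\<^sub>v d"
    if "?E N v = 0\<^sub>v d" "v \<in> carrier_vec d" "H *\<^sub>v v = of_nat p \<cdot>\<^sub>v v" "?F s v = 0\<^sub>v d" "s \<le> p"
    for N v p s
    using that
  proof (induction N arbitrary: v p s)
    case (Suc N)
    note IH = Suc.IH and v = \<open>v \<in> carrier_vec d\<close> and eig = \<open>H *\<^sub>v v = of_nat p \<cdot>\<^sub>v v\<close>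
    have Ev: "E *\<^sub>v v \<in> carrier_vec d" using carr v by simp
    show ?case
      using Suc.prems(4,5)
    proof (induction s)
      case (Suc s)
      have smult_zero: "k \<cdot>\<^sub>v 0\<^sub>v d = 0\<^sub>v d" for k :: complex by (intro eq_vecI) auto
      have F2: "?F (Suc (Suc s)) v = 0\<^sub>v d" using Suc.prems(1) carr by (simp add: mult_mat_zero_vec)
      have carr0: "?F k (E *\<^sub>v v) \<in> carrier_vec d" "?F k v \<in> carrier_vec d" for k
        using carr v Ev by simp_all
      have "0\<^sub>v d = ?F (Suc (Suc s)) (E *\<^sub>v v)
          + (of_nat (Suc (Suc s)) * (of_nat p - of_nat (Suc s))) \<cdot>\<^sub>v ?F (Suc s) v"
        using E_funpow_F[OF v eig, of "Suc s"] unfolding F2 mult_mat_zero_vec[OF carr(1)] .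
      then have "?F (Suc (Suc s)) (E *\<^sub>v v) = 0\<^sub>v d"
        using carr0(1)[of "Suc (Suc s)"] unfolding Suc.prems(1) by (simp add: smult_zero)
      moreover have "?E N (E *\<^sub>v v) = 0\<^sub>v d"
        using \<open>?E (Suc N) v = 0\<^sub>v d\<close> by (simp add: funpow_swap1)
      moreover have "H *\<^sub>v (E *\<^sub>v v) = of_nat (p + 2) \<cdot>\<^sub>v (E *\<^sub>v v)"
        using eigen_shift[OF carr(3,1) v HE eig, of 1]
        by (simp add: add.commute)
      moreover have "Suc (Suc s) \<le> p + 2" using \<open>Suc s \<le> p\<close> by simp
      ultimately have Ev0: "E *\<^sub>v v = 0\<^sub>v d"
        using IH[of "E *\<^sub>v v" "p + 2" "Suc (Suc s)"] \<open>Suc s \<le> p\<close> Ev by blast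
      have "0\<^sub>v d = (of_nat (Suc s) * (of_nat p - of_nat s)) \<cdot>\<^sub>v ?F s v"
        using E_funpow_F[OF v eig, of s] carr carr0(2)[of s] unfolding Suc.prems(1) Ev0 mult_mat_zero_vec[OF carr(1)]
        by (simp del: funpow.simps)
      moreover have "of_nat (Suc s) * (of_nat p - of_nat s) \<noteq> (0 :: complex)"
        using \<open>Suc s \<le> p\<close> by (simp del: of_nat_Suc flip: of_nat_diff)
      ultimately have "?F s v = 0\<^sub>v d"
        using carr0(2)[of s] by (auto simp: vec_eq_iff)
      then show ?case using \<open>Suc s \<le> p\<close> Suc.IH by simp
    qed simp
  qed simp
  obtain N where "?E N v = 0\<^sub>v d"
    using E_nilpotent_on_eigenvector[OF v(1) eig] by blast
  then show ?thesis using claim[OF _ v(1) eig, of N p] v(2) by auto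
qed

end

section \<open>The triples of the long roots\<close>

text \<open>
  A root vector for the long root \<open>2 L\<^sub>i\<close> if \<open>i < n\<close>, and for
  \<open>-2 L\<^bsub>i-n\<^esub>\<close> if \<open>i\<close> lies in the second half. Indexing
  both signs by one number lets the reflection argument treat them alike.
\<close>
definition root_vec :: "nat \<Rightarrow> nat \<Rightarrow> complex mat" where
  "root_vec n i = mat (2 * n) (2 * n) (\<lambda>(r, c). if r = i \<and> c = dual_idx n i then 1 else 0)"

lemma root_vec_carrier [simp]:
  "root_vec n i \<in> carrier_mat (2 * n) (2 * n)"
  "dim_row (root_vec n i) = 2 * n" "dim_col (root_vec n i) = 2 * n"
  by (simp_all add: root_vec_def)

lemma root_vec_index [simp]:
  "r < 2 * n \<Longrightarrow> c < 2 * n \<Longrightarrow>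
     root_vec n i $$ (r, c) = (if r = i \<and> c = dual_idx n i then 1 else 0)"
  by (simp add: root_vec_def)

lemma root_vec_in_sp_algC:
  assumes "i < 2 * n"
  shows "root_vec n i \<in> sp_algC n"
  unfolding mem_sp_algC_iff
proof (intro conjI allI impI)
  fix r c assume rc: "r < 2 * n" "c < 2 * n"
  have "dual_idx n c = i \<and> dual_idx n r = dual_idx n i \<longleftrightarrow> r = i \<and> c = dual_idx n i"
    using rc assms by (metis dual_idx_dual_idx)
  then show "root_vec n i $$ (dual_idx n c, dual_idx n r)
      = - idx_sign n r * idx_sign n c * root_vec n i $$ (r, c)"
    using rc assms by (simp add: idx_sign_dual_idx)
qed simp

definition torus_unit :: "nat \<Rightarrow> nat \<Rightarrow> complex mat" where
  "torus_unit n i = torus_elt n (\<lambda>j. if j = i then 1 else 0)"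

lemma bracket_torus_elt_root_vec:
  assumes "i < 2 * n"
  shows "bracket (torus_elt n a) (root_vec n i) = (2 * \<i> * of_real (diag_entry n a i)) \<cdot>\<^sub>m root_vec n i"
  unfolding bracket_torus_elt[OF root_vec_carrier(1)]
  using assms by (intro eq_matI) (auto simp: diag_entry_dual_idx)

lemma bracket_root_vecs:
  assumes "i < n"
  shows "bracket (root_vec n i) (root_vec n (dual_idx n i)) = - \<i> \<cdot>\<^sub>m torus_unit n i"
proof -
  have i: "i < 2 * n" "dual_idx n i < 2 * n" "dual_idx n i \<noteq> i" using assms by (auto simp: dual_idx_def)
  have prod: "(root_vec n k * root_vec n (dual_idx n k)) $$ (r, c) = (if r = k \<and> c = k then 1 else 0)"
    if "k < 2 * n" "r < 2 * n" "c < 2 * n" for k r c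
  proof -
    have "(root_vec n k * root_vec n (dual_idx n k)) $$ (r, c)
        = (\<Sum>s<2 * n. root_vec n k $$ (r, s) * root_vec n (dual_idx n k) $$ (s, c))"
      using that by (auto simp: scalar_prod_def atLeast0LessThan root_vec_def)
    also have "\<dots> = (\<Sum>s<2 * n. if s = dual_idx n k then if r = k \<and> c = k then 1 else 0 else 0)"
      using that by (intro sum.cong) auto
    finally show ?thesis using that by simp
  qed
  have diag: "diag_entry n (\<lambda>j. if j = i then 1 else 0) r
      = (if r = i then 1 else if r = dual_idx n i then - 1 else 0)" if "r < 2 * n" for r
    using that assms by (auto simp: diag_entry_def dual_idx_def)
  show ?thesis
  proof (rule eq_matI)
    fix r c assume "r < dim_row (- \<i> \<cdot>\<^sub>m torus_unit n i)" "c < dim_col (- \<i> \<cdot>\<^sub>m torus_unit n i)"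
    then have rc: "r < 2 * n" "c < 2 * n" by (auto simp: torus_unit_def torus_elt_def)
    have "bracket (root_vec n i) (root_vec n (dual_idx n i)) $$ (r, c)
        = (root_vec n i * root_vec n (dual_idx n i)) $$ (r, c)
        - (root_vec n (dual_idx n i) * root_vec n i) $$ (r, c)"
      using rc by (simp add: bracket_def root_vec_def)
    also have "\<dots> = (if r = i \<and> c = i then 1 else 0) - (if r = dual_idx n i \<and> c = dual_idx n i then 1 else 0)"
      using prod[of i r c] prod[of "dual_idx n i" r c] i rc by simp
    also have "\<dots> = (- \<i> \<cdot>\<^sub>m torus_unit n i) $$ (r, c)"
      using rc i by (auto simp: torus_unit_def diag torus_elt_eq_mat_diag mat_diag_def)
    finally show "bracket (root_vec n i) (root_vec n (dual_idx n i)) $$ (r, c)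
      = (- \<i> \<cdot>\<^sub>m torus_unit n i) $$ (r, c)" .
  qed (simp_all add: bracket_def root_vec_def torus_unit_def torus_elt_def)
qed

lemma bracket_smult_left:
  fixes A B :: "complex mat"
  assumes "A \<in> carrier_mat d d" "B \<in> carrier_mat d d"
  shows "bracket (k \<cdot>\<^sub>m A) B = k \<cdot>\<^sub>m bracket A B"
  unfolding bracket_def using assms
  by (intro eq_matI) (auto simp: algebra_simps)

lemma bracket_swap:
  fixes A B :: "complex mat"
  assumes "A \<in> carrier_mat d d" "B \<in> carrier_mat d d"
  shows "bracket B A = (- 1) \<cdot>\<^sub>m bracket A B"
  unfolding bracket_def using assms by (intro eq_matI) auto

lemma is_repD:
  assumes "is_rep n d \<rho>" "X \<in> sp_algC n"
  shows "\<rho> X \<in> carrier_mat d d" "\<rho> (k \<cdot>\<^sub>m X) = k \<cdot>\<^sub>m \<rho> X"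
    "Y \<in> sp_algC n \<Longrightarrow> \<rho> (bracket X Y) = bracket (\<rho> X) (\<rho> Y)"
  using assms by (auto simp: is_rep_def)

lemma rep_bracket_torus_root_vec:
  assumes "is_rep n d \<rho>" "i < 2 * n"
  shows "bracket (\<rho> (torus_elt n a)) (\<rho> (root_vec n i))
    = (2 * \<i> * of_real (diag_entry n a i)) \<cdot>\<^sub>m \<rho> (root_vec n i)"
  using is_repD[OF assms(1)] assms(2)
  by (simp add: root_vec_in_sp_algC torus_elt_in_sp_algC bracket_torus_elt_root_vec
      flip: is_repD(3)[OF assms(1)])

text \<open>
  For \<open>i\<close> in the second half, the roles of raising and lowering are exchanged and
  \<open>H\<close> changes sign.
\<close>
lemma rep_sl2_triple:
  assumes rep: "is_rep n d \<rho>" and i: "i < 2 * n"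
  defines "E \<equiv> \<rho> (root_vec n i)" and "F \<equiv> \<rho> (root_vec n (dual_idx n i))"
  defines "T \<equiv> \<rho> (torus_unit n (if i < n then i else i - n))"
  shows "sl2_triple d E F ((- idx_sign n i * \<i>) \<cdot>\<^sub>m T)"
proof
  let ?j = "if i < n then i else i - n"
  have j: "?j < n" using i by auto
  have diag: "of_real (diag_entry n (\<lambda>k. if k = ?j then 1 else 0) i) = idx_sign n i"
    using i by (auto simp: diag_entry_def idx_sign_def)
  have T: "T \<in> carrier_mat d d"
    using is_repD(1)[OF rep] by (simp add: T_def torus_unit_def torus_elt_in_sp_algC)
  then show carr: "E \<in> carrier_mat d d" "F \<in> carrier_mat d d" "(- idx_sign n i * \<i>) \<cdot>\<^sub>m T \<in> carrier_mat d d"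
    using is_repD(1)[OF rep] i
    by (auto simp: E_def F_def root_vec_in_sp_algC)
  have smult: "k \<cdot>\<^sub>m (l \<cdot>\<^sub>m A) = (k * l) \<cdot>\<^sub>m A" for k l and A :: "complex mat"
    by (rule eq_matI) (simp_all add: mult.assoc)
  have "bracket T E = (2 * \<i> * idx_sign n i) \<cdot>\<^sub>m E"
    using rep_bracket_torus_root_vec[OF rep i] unfolding E_def T_def torus_unit_def diag[symmetric] .
  then show "bracket ((- idx_sign n i * \<i>) \<cdot>\<^sub>m T) E = 2 \<cdot>\<^sub>m E"
    unfolding bracket_smult_left[OF T carr(1)] by (simp add: smult mult_ac)
  have "bracket T F = (2 * \<i> * - idx_sign n i) \<cdot>\<^sub>m F"
    using rep_bracket_torus_root_vec[OF rep dual_idx_less[OF i]]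
    unfolding F_def T_def torus_unit_def diag[symmetric] diag_entry_dual_idx[OF i] of_real_minus .
  then show "bracket ((- idx_sign n i * \<i>) \<cdot>\<^sub>m T) F = (- 2) \<cdot>\<^sub>m F"
    unfolding bracket_smult_left[OF T carr(2)] by (simp add: smult mult_ac)
  have base: "bracket (\<rho> (root_vec n ?j)) (\<rho> (root_vec n (dual_idx n ?j))) = - \<i> \<cdot>\<^sub>m T"
    using is_repD[OF rep] j
    by (simp add: T_def root_vec_in_sp_algC torus_elt_in_sp_algC torus_unit_def bracket_root_vecs
      flip: is_repD(3)[OF rep])
  show "bracket E F = (- idx_sign n i * \<i>) \<cdot>\<^sub>m T"
  proof (cases "i < n")
    case True
    then show ?thesis using base by (simp add: E_def F_def idx_sign_def)
  next
    case False
    then have "dual_idx n i = ?j" "dual_idx n ?j = i" using i by (auto simp: dual_idx_def)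
    then have "bracket F E = - \<i> \<cdot>\<^sub>m T" using base by (simp add: E_def F_def)
    then show ?thesis
      using bracket_swap[OF carr(2,1)] False T by (auto intro!: eq_matI simp: idx_sign_def)
  qed
qed

section \<open>The set of weights is symmetric\<close>

definition int_comb :: "nat \<Rightarrow> (nat \<Rightarrow> int) \<Rightarrow> complex mat \<Rightarrow> complex" where
  "int_comb n q \<xi> = (\<Sum>i<n. of_int (q i) * L i \<xi>)"

lemma int_comb_torus_unit: "i < n \<Longrightarrow> int_comb n q (torus_unit n i) = \<i> * of_int (q i)"
  by (simp add: int_comb_def torus_unit_def L_torus_elt if_distrib cong: if_cong)

lemma int_comb_upd:
  "i < n \<Longrightarrow> int_comb n (q(i := t)) \<xi> = int_comb n q \<xi> + of_int (t - q i) * L i \<xi>"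
  by (simp add: int_comb_def sum.remove[of "{..<n}" i] algebra_simps)

text \<open>
  This is the reflection in the root \<open>2 L\<^sub>i\<close>. On a vector of weight
  \<open>\<Sum> q\<^sub>j L\<^sub>j\<close>, the element \<open>H\<close> of the triple acts by
  \<open>q\<^sub>i\<close>; applying the root vector of the opposite sign
  \<open>\<bar>q\<^sub>i\<bar>\<close> times changes the weight by \<open>-2 q\<^sub>i
  L\<^sub>i\<close> and does not kill the vector.
\<close>
lemma weight_reflect:
  assumes rep: "is_rep n d \<rho>" and i: "i < n"
    and wt: "is_weight n d \<rho> (restrict (int_comb n q) (torus n))"
  shows "is_weight n d \<rho> (restrict (int_comb n (q(i := - q i))) (torus n))"
proof -
  obtain v where v: "v \<in> carrier_vec d" "v \<noteq> 0\<^sub>v d"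
    and eig: "\<And>a. \<rho> (torus_elt n a) *\<^sub>v v = int_comb n q (torus_elt n a) \<cdot>\<^sub>v v"
    using wt by (auto simp: is_weight_def torus_def)
  \<comment> \<open>The root vectors are chosen so that \<open>H\<close> acts on \<open>v\<close> by a nonnegative number \<open>p\<close>.\<close>
  define k where "k = (if q i \<ge> 0 then i else dual_idx n i)"
  define p where "p = nat \<bar>q i\<bar>"
  define F where "F = \<rho> (root_vec n (dual_idx n k))"
  have k: "k < 2 * n" using i by (simp add: k_def)
  have kj: "(if k < n then k else k - n) = i" using i by (auto simp: k_def dual_idx_def)
  have sgn: "idx_sign n k * of_int (q i) = of_nat p"
    using i by (auto simp: k_def p_def idx_sign_def dual_idx_def)
  let ?H = "(- idx_sign n k * \<i>) \<cdot>\<^sub>m \<rho> (torus_unit n i)"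
  interpret sl2_triple d "\<rho> (root_vec n k)" F ?H
    using rep_sl2_triple[OF rep k] unfolding kj F_def .
  have T: "\<rho> (torus_elt n a) \<in> carrier_mat d d" for a
    by (rule is_repD(1)[OF rep torus_elt_in_sp_algC])
  have "?H *\<^sub>v v = (- idx_sign n k * \<i>) \<cdot>\<^sub>v (\<rho> (torus_unit n i) *\<^sub>v v)"
    using T v by (intro smult_mult_mat_vec) (auto simp: torus_unit_def)
  also have "\<dots> = (- idx_sign n k * \<i>) \<cdot>\<^sub>v ((\<i> * of_int (q i)) \<cdot>\<^sub>v v)"
    using eig i int_comb_torus_unit[OF i, of q] by (simp add: torus_unit_def)
  also have "\<dots> = of_nat p \<cdot>\<^sub>v v"
    unfolding smult_smult_assoc sgn[symmetric] by (simp add: mult_ac)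
  finally have "?H *\<^sub>v v = of_nat p \<cdot>\<^sub>v v" .
  then have nz: "(((*\<^sub>v) F) ^^ p) v \<noteq> 0\<^sub>v d"
    using v by (intro F_power_nonzero)
  have "\<rho> (torus_elt n a) *\<^sub>v (((*\<^sub>v) F) ^^ p) v
      = int_comb n (q(i := - q i)) (torus_elt n a) \<cdot>\<^sub>v (((*\<^sub>v) F) ^^ p) v" for a
  proof -
    have "\<rho> (torus_elt n a) *\<^sub>v (((*\<^sub>v) F) ^^ p) v
        = (int_comb n q (torus_elt n a) + of_nat p * (2 * \<i> * of_real (diag_entry n a (dual_idx n k))))
          \<cdot>\<^sub>v (((*\<^sub>v) F) ^^ p) v"
      using k by (intro eigen_shift[OF T carr(2) v(1) _ eig])
        (simp add: F_def rep_bracket_torus_root_vec[OF rep])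
    moreover have "of_real (diag_entry n a (dual_idx n k)) = - (idx_sign n k * of_real (a i))"
      using k kj by (auto simp: diag_entry_dual_idx) (auto simp: diag_entry_def idx_sign_def)
    moreover have "of_int (q i) = idx_sign n k * (of_nat p :: complex)"
      unfolding sgn[symmetric] by simp
    ultimately have "\<rho> (torus_elt n a) *\<^sub>v (((*\<^sub>v) F) ^^ p) v
        = (int_comb n q (torus_elt n a) - 2 * of_int (q i) * L i (torus_elt n a)) \<cdot>\<^sub>v (((*\<^sub>v) F) ^^ p) v"
      using i by (simp add: L_torus_elt mult_ac)
    then show ?thesis using i by (simp add: int_comb_upd)
  qed
  then show ?thesis
    unfolding is_weight_def using nz v(1) carr(2) by (auto simp: torus_def intro!: bexI)
qed

text \<open>
  Reflect in the roots \<open>2 L\<^sub>1, \<dots>, 2 L\<^sub>n\<close> one after the other.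
\<close>
lemma weight_uminus:
  assumes rep: "is_rep n d \<rho>" and wt: "is_weight n d \<rho> (restrict (int_comb n q) (torus n))"
  shows "is_weight n d \<rho> (restrict (int_comb n (\<lambda>i. - q i)) (torus n))"
proof -
  have "is_weight n d \<rho> (restrict (int_comb n (\<lambda>i. if i < k then - q i else q i)) (torus n))" if "k \<le> n" for k
    using that
  proof (induction k)
    case (Suc k)
    let ?q = "\<lambda>i. if i < k then - q i else q i"
    have "is_weight n d \<rho> (restrict (int_comb n (?q(k := - ?q k))) (torus n))"
      using Suc.prems by (intro weight_reflect[OF rep _ Suc.IH]) auto
    moreover have "?q(k := - ?q k) = (\<lambda>i. if i < Suc k then - q i else q i)"
      by (auto simp: fun_eq_iff less_Suc_eq)
    ultimately show ?case by (simp only:)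
  next
    case 0
    show ?case using wt by (simp only: if_False not_less_zero)
  qed
  moreover have "int_comb n (\<lambda>i. if i < n then - q i else q i) = int_comb n (\<lambda>i. - q i)"
    by (simp add: int_comb_def fun_eq_iff)
  ultimately show ?thesis by (metis order.refl)
qed

section \<open>Highest and lowest weights\<close>

lemma finite_pos_roots: "finite (pos_roots n)"
proof -
  have "pos_roots n \<subseteq> (\<lambda>(i, j) \<xi>. L i \<xi> + L j \<xi>) ` ({..<n} \<times> {..<n}) \<union>
      (\<lambda>(i, j) \<xi>. L i \<xi> - L j \<xi>) ` ({..<n} \<times> {..<n})"
    by (auto simp: pos_roots_def image_iff)
  then show ?thesis by (rule finite_subset) simp
qed

lemma pos_root_int_comb:
  assumes "\<alpha> \<in> pos_roots n"
  shows "\<exists>q. \<alpha> = int_comb n q"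
proof -
  have comb: "int_comb n (\<lambda>l. of_bool (l = i) + e * of_bool (l = j)) = (\<lambda>\<xi>. L i \<xi> + of_int e * L j \<xi>)"
    if "i < n" "j < n" for i j e
  proof
    fix \<xi>
    have comb: "int_comb n (\<lambda>l. of_bool (l = i) + e * of_bool (l = j)) \<xi>
        = (\<Sum>l<n. (if l = i then L l \<xi> else 0) + (if l = j then of_int e * L l \<xi> else 0))"
      unfolding int_comb_def by (rule sum.cong) (auto simp: algebra_simps)
    then show "int_comb n (\<lambda>l. of_bool (l = i) + e * of_bool (l = j)) \<xi> = L i \<xi> + of_int e * L j \<xi>"
      using that by (simp add: sum.distrib)
  qed
  from assms consider i j where "i < n" "j < n" "\<alpha> = (\<lambda>\<xi>. L i \<xi> + L j \<xi>)"
    | i j where "i < n" "j < n" "\<alpha> = (\<lambda>\<xi>. L i \<xi> - L j \<xi>)"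
    unfolding pos_roots_def by (auto dest: le_less_trans less_trans)
  then show ?thesis
  proof cases
    case 1
    then have "\<alpha> = int_comb n (\<lambda>l. of_bool (l = i) + 1 * of_bool (l = j))"
      using comb[of i j "1"] by simp
    then show ?thesis by blast
  next
    case 2
    then have "\<alpha> = int_comb n (\<lambda>l. of_bool (l = i) + (- 1) * of_bool (l = j))"
      using comb[of i j "- 1"] by simp
    then show ?thesis by blast
  qed
qed

text \<open>
  Roots are integral combinations of the \<open>L\<^sub>i\<close>, hence so is every weight below
  an integral one. This supplies the integrality that the reflections need.
\<close>
lemma weight_below_int_comb:
  assumes "weight_le n \<mu> (restrict (int_comb n q) (torus n))"
  shows "\<exists>q'. \<forall>\<xi>\<in>torus n. \<mu> \<xi> = int_comb n q' \<xi>"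
proof -
  obtain c :: "(complex mat \<Rightarrow> complex) \<Rightarrow> nat" where
    c: "\<And>\<xi>. \<xi> \<in> torus n \<Longrightarrow> int_comb n q \<xi> - \<mu> \<xi> = (\<Sum>\<alpha>\<in>pos_roots n. of_nat (c \<alpha>) * \<alpha> \<xi>)"
    using assms by (auto simp: weight_le_def)
  have "\<forall>\<alpha>\<in>pos_roots n. \<exists>q. \<alpha> = int_comb n q" using pos_root_int_comb by blast
  then obtain coeffs where coeffs: "\<forall>\<alpha>\<in>pos_roots n. \<alpha> = int_comb n (coeffs \<alpha>)"
    by (rule bchoice[THEN exE])
  define q' where "q' i = q i - (\<Sum>\<alpha>\<in>pos_roots n. int (c \<alpha>) * coeffs \<alpha> i)" for i
  have "\<mu> \<xi> = int_comb n q' \<xi>" if "\<xi> \<in> torus n" for \<xi>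
  proof -
    have "(\<Sum>\<alpha>\<in>pos_roots n. of_nat (c \<alpha>) * \<alpha> \<xi>)
        = (\<Sum>\<alpha>\<in>pos_roots n. \<Sum>i<n. of_int (int (c \<alpha>) * coeffs \<alpha> i) * L i \<xi>)"
    proof (rule sum.cong)
      fix \<alpha> assume "\<alpha> \<in> pos_roots n"
      with coeffs have "\<alpha> = int_comb n (coeffs \<alpha>)" by (rule bspec)
      then have "\<alpha> \<xi> = int_comb n (coeffs \<alpha>) \<xi>" by (rule fun_cong)
      then show "of_nat (c \<alpha>) * \<alpha> \<xi> = (\<Sum>i<n. of_int (int (c \<alpha>) * coeffs \<alpha> i) * L i \<xi>)"
        by (simp add: int_comb_def sum_distrib_left mult.assoc)
    qed simp
    also have "\<dots> = (\<Sum>i<n. of_int (\<Sum>\<alpha>\<in>pos_roots n. int (c \<alpha>) * coeffs \<alpha> i) * L i \<xi>)"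
      by (subst sum.swap) (simp add: sum_distrib_right)
    finally have "\<mu> \<xi> = int_comb n q \<xi> - \<dots>" using c[OF that] by (simp add: algebra_simps)
    also have "\<dots> = int_comb n q' \<xi>"
      by (simp add: int_comb_def q'_def left_diff_distrib sum_subtractf)
    finally show ?thesis .
  qed
  then show ?thesis by blast
qed

text \<open>
  Evaluate at a regular dominant element, where every positive root is positive: a combination of
  positive roots with natural coefficients that vanishes there has all coefficients zero.
\<close>
lemma weight_le_antisym:
  assumes "weight_le n \<mu> \<nu>" "weight_le n \<nu> \<mu>" and \<xi>: "\<xi> \<in> torus n"
  shows "\<mu> \<xi> = \<nu> \<xi>"
proof -
  obtain c :: "(complex mat \<Rightarrow> complex) \<Rightarrow> nat" where
    c: "\<And>\<xi>. \<xi> \<in> torus n \<Longrightarrow> \<nu> \<xi> - \<mu> \<xi> = (\<Sum>\<alpha>\<in>pos_roots n. of_nat (c \<alpha>) * \<alpha> \<xi>)"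
    using assms(1) unfolding weight_le_def by blast
  obtain c' :: "(complex mat \<Rightarrow> complex) \<Rightarrow> nat" where
    c': "\<And>\<xi>. \<xi> \<in> torus n \<Longrightarrow> \<mu> \<xi> - \<nu> \<xi> = (\<Sum>\<alpha>\<in>pos_roots n. of_nat (c' \<alpha>) * \<alpha> \<xi>)"
    using assms(2) unfolding weight_le_def by blast
  \<comment> \<open>The coordinates \<open>n, n - 1, \<dots>, 1\<close> are strictly decreasing and positive.\<close>
  define \<delta> where "\<delta> = torus_elt n (\<lambda>i. real (n - i))"
  have \<delta>: "\<delta> \<in> torus n" by (auto simp: \<delta>_def torus_def)
  have pos: "0 < Im (\<alpha> \<delta>)" if "\<alpha> \<in> pos_roots n" for \<alpha>
    using that by (auto simp: pos_roots_def \<delta>_def L_torus_elt)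
  have "(\<Sum>\<alpha>\<in>pos_roots n. of_nat (c \<alpha> + c' \<alpha>) * \<alpha> \<delta>) = 0"
    by (simp add: distrib_right sum.distrib flip: c[OF \<delta>] c'[OF \<delta>])
  then have "(\<Sum>\<alpha>\<in>pos_roots n. real (c \<alpha> + c' \<alpha>) * Im (\<alpha> \<delta>)) = 0"
    by (auto dest: arg_cong[of _ _ Im])
  then have "\<forall>\<alpha>\<in>pos_roots n. real (c \<alpha> + c' \<alpha>) * Im (\<alpha> \<delta>) = 0"
    by (subst (asm) sum_nonneg_eq_0_iff)
      (simp_all add: finite_pos_roots less_imp_le[OF pos] mult_nonneg_nonneg del: of_nat_add)
  then have "c \<alpha> = 0" if "\<alpha> \<in> pos_roots n" for \<alpha>
    using pos[OF that] that by auto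
  then show ?thesis using c[OF \<xi>] by simp
qed

lemma highest_weight_eqI:
  assumes "is_highest_weight n d \<rho> \<omega>"
  shows "highest_weight n d \<rho> = \<omega>"
  unfolding highest_weight_def
proof (rule the_equality)
  fix \<nu> assume "is_highest_weight n d \<rho> \<nu>"
  with assms have "weight_le n \<nu> \<omega>" "weight_le n \<omega> \<nu>" "\<nu> \<in> extensional (torus n)" "\<omega> \<in> extensional (torus n)"
    by (auto simp: is_highest_weight_def is_weight_def)
  then show "\<nu> = \<omega>" by (intro extensionalityI[of _ "torus n"] weight_le_antisym)
qed fact

lemma lowest_weight_eqI:
  assumes "is_lowest_weight n d \<rho> \<omega>"
  shows "lowest_weight n d \<rho> = \<omega>"
  unfolding lowest_weight_def
proof (rule the_equality)
  fix \<nu> assume "is_lowest_weight n d \<rho> \<nu>"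
  with assms have "weight_le n \<nu> \<omega>" "weight_le n \<omega> \<nu>" "\<nu> \<in> extensional (torus n)" "\<omega> \<in> extensional (torus n)"
    by (auto simp: is_lowest_weight_def is_weight_def)
  then show "\<nu> = \<omega>" by (intro extensionalityI[of _ "torus n"] weight_le_antisym)
qed fact

lemma int_comb_uminus: "int_comb n (\<lambda>i. - q i) \<xi> = - int_comb n q \<xi>"
  by (simp add: int_comb_def sum_negf)

text \<open>
  Negation permutes the weights and reverses their order.
\<close>
lemma is_lowest_weight_uminus_highest:
  assumes rep: "is_rep n d \<rho>"
    and hw: "is_highest_weight n d \<rho> (restrict (int_comb n q) (torus n))"
  shows "is_lowest_weight n d \<rho> (restrict (int_comb n (\<lambda>i. - q i)) (torus n))"
  unfolding is_lowest_weight_def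
proof (intro conjI allI impI)
  show "is_weight n d \<rho> (restrict (int_comb n (\<lambda>i. - q i)) (torus n))"
    using hw by (intro weight_uminus[OF rep]) (simp add: is_highest_weight_def)
  fix \<mu> assume \<mu>: "is_weight n d \<rho> \<mu>"
  then have "weight_le n \<mu> (restrict (int_comb n q) (torus n))"
    using hw by (simp add: is_highest_weight_def)
  then obtain q' where "\<forall>\<xi>\<in>torus n. \<mu> \<xi> = int_comb n q' \<xi>"
    using weight_below_int_comb by blast
  then have \<mu>_eq: "\<mu> = restrict (int_comb n q') (torus n)"
    using \<mu> by (intro extensionalityI[of _ "torus n"]) (auto simp: is_weight_def)
  have "is_weight n d \<rho> (restrict (int_comb n (\<lambda>i. - q' i)) (torus n))"
    using \<mu> unfolding \<mu>_eq by (rule weight_uminus[OF rep])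
  then have "weight_le n (restrict (int_comb n (\<lambda>i. - q' i)) (torus n)) (restrict (int_comb n q) (torus n))"
    using hw by (simp add: is_highest_weight_def)
  then show "weight_le n (restrict (int_comb n (\<lambda>i. - q i)) (torus n)) \<mu>"
    unfolding weight_le_def \<mu>_eq by (simp add: int_comb_uminus add.commute)
qed

lemma fund_weight_eq_int_comb:
  assumes "k \<le> n"
  shows "fund_weight n k = restrict (int_comb n (\<lambda>i. of_bool (i < k))) (torus n)"
proof -
  have "(\<Sum>i<k. L i \<xi>) = int_comb n (\<lambda>i. of_bool (i < k)) \<xi>" for \<xi>
  proof -
    have "int_comb n (\<lambda>i. of_bool (i < k)) \<xi> = (\<Sum>i<n. if i < k then L i \<xi> else 0)"
      unfolding int_comb_def by (rule sum.cong) auto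
    also have "\<dots> = (\<Sum>i\<in>{i \<in> {..<n}. i < k}. L i \<xi>)" by (rule sum.inter_filter[symmetric]) simp
    also have "{i \<in> {..<n}. i < k} = {..<k}" using assms by auto
    finally show ?thesis by simp
  qed
  then show ?thesis by (simp add: fund_weight_def)
qed

text \<open>
  The lowest weight being minus the highest one, the difference in the definition doubles the
  value \<open>a\<^sub>0 + \<dots> + a\<^bsub>k-1\<^esub>\<close> of the fundamental weight.
\<close>
lemma r_number_fund_rep:
  assumes fund: "is_fund_rep n k d \<rho>" and "k \<le> n"
  shows "r_number n d \<rho> (torus_elt n a) = 2 * (\<Sum>i<k. a i)"
proof -
  have rep: "is_rep n d \<rho>" and hw: "is_highest_weight n d \<rho> (fund_weight n k)"
    using fund by (auto simp: is_fund_rep_def is_irrep_def)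
  have high: "highest_weight n d \<rho> = fund_weight n k" by (rule highest_weight_eqI[OF hw])
  have low: "lowest_weight n d \<rho> = restrict (int_comb n (\<lambda>i. - of_bool (i < k))) (torus n)"
    using is_lowest_weight_uminus_highest[OF rep] hw fund_weight_eq_int_comb[OF assms(2)]
    by (intro lowest_weight_eqI) simp
  have torus: "torus_elt n a \<in> torus n" by (simp add: torus_def)
  have "fund_weight n k (torus_elt n a) = (\<Sum>i<k. L i (torus_elt n a))"
    using torus by (simp add: fund_weight_def)
  also have "\<dots> = \<i> * of_real (\<Sum>i<k. a i)"
    using assms(2) by (simp add: L_torus_elt sum_distrib_left)
  finally have at_a: "fund_weight n k (torus_elt n a) = \<i> * of_real (\<Sum>i<k. a i)" .
  then have "lowest_weight n d \<rho> (torus_elt n a) = - (\<i> * of_real (\<Sum>i<k. a i))"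
    using torus fund_weight_eq_int_comb[OF assms(2)] by (simp add: low int_comb_uminus)
  then show ?thesis by (simp add: r_number_def high at_a)
qed

section \<open>The bounds\<close>

text \<open>
  The flat bound \<open>2 m\<close> is the better one for \<open>i < p\<close>, the bound \<open>n
  - i\<close> afterwards; with the first used up to \<open>p\<close> and the second beyond, the
  right-hand side grows by exactly \<open>2 (n - k)\<close> when \<open>k\<close> does by one.
\<close>
lemma twice_sum_staircase_le:
  fixes h :: "nat \<Rightarrow> nat"
  assumes bound: "\<And>i. i < n \<Longrightarrow> h i \<le> 2 * m" and stairs: "\<And>i. i < n \<Longrightarrow> h i \<le> n - i"
    and p: "2 * m \<le> n" "p = n - 2 * m + 1" and k: "k \<le> n"
  shows "2 * (\<Sum>i<k. real (h i)) \<le> 4 * real m * real k"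
    and "p \<le> k \<Longrightarrow> 2 * (\<Sum>i<k. real (h i))
      \<le> 4 * real m * real p + (real k - real p) * (2 * real m + real n - real k)"
proof -
  have flat: "2 * (\<Sum>i<k. real (h i)) \<le> 4 * real m * real k" if "k \<le> n" for k
  proof -
    have "(\<Sum>i<k. real (h i)) \<le> (\<Sum>i<k. 2 * real m)"
    proof (rule sum_mono)
      fix i assume "i \<in> {..<k}"
      then have "h i \<le> 2 * m" using bound that by simp
      then have "real (h i) \<le> real (2 * m)" by (rule of_nat_mono)
      then show "real (h i) \<le> 2 * real m" by simp
    qed
    then show ?thesis by (simp add: mult_ac)
  qed
  show "2 * (\<Sum>i<k. real (h i)) \<le> 4 * real m * real k" using k by (rule flat)
  assume "p \<le> k"
  then show "2 * (\<Sum>i<k. real (h i))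
      \<le> 4 * real m * real p + (real k - real p) * (2 * real m + real n - real k)"
    using k
  proof (induction k rule: dec_induct)
    case base
    show ?case using flat[OF base.prems] by (simp add: mult_ac)
  next
    case (step k)
    have "real (h k) \<le> real n - real k" using stairs[of k] step.prems by linarith
    moreover have "real p = real n - 2 * real m + 1" using p by (simp add: of_nat_diff)
    ultimately show ?case using step by (simp add: algebra_simps)
  qed
qed

theorem proposition6p7:
  fixes n m :: nat and \<xi> :: "complex mat"
  assumes "n \<ge> 1"
    and "symmetric_canonical n \<xi>"
    and "N_orbit n \<xi> = iota n ` quat_grass m n"
    and "2 * m \<le> n"
  shows "(\<forall>k d \<rho>. 1 \<le> k \<and> k \<le> n \<and> is_fund_rep n k d \<rho> \<longrightarrow>
            (k \<le> n - 2 * m + 1 \<longrightarrow> r_number n d \<rho> \<xi> \<le> 4 * real m * real k) \<and>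
            (k > n - 2 * m + 1 \<longrightarrow>
               r_number n d \<rho> \<xi> \<le> 4 * real m * (real n - 2 * real m + 1)
                 + (real k - real n + 2 * real m - 1) * (2 * real m + real n - real k)))
       \<and> (\<forall>d \<rho>. is_fund_rep n 1 d \<rho> \<longrightarrow> r_number n d \<rho> \<xi> \<le> 4 * real m)
       \<and> (n \<ge> 2 \<longrightarrow> (\<forall>d \<rho>. is_fund_rep n 2 d \<rho> \<longrightarrow>
            (2 * m < n \<longrightarrow> r_number n d \<rho> \<xi> \<le> 8 * real m) \<and>
            (2 * m = n \<longrightarrow> r_number n d \<rho> \<xi> \<le> 8 * real m - 2)))"
proof -
  have "\<xi> \<in> int_lattice_dom n" using assms(2) by (simp add: symmetric_canonical_def)
  then obtain h :: "nat \<Rightarrow> nat" where \<xi>: "\<xi> = torus_elt n (\<lambda>i. real (h i))"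
    and "\<forall>i j. i \<le> j \<longrightarrow> j < n \<longrightarrow> h j \<le> h i"
    by (rule int_lattice_dom_cases) blast
  then have anti: "\<And>i j. i \<le> j \<Longrightarrow> j < n \<Longrightarrow> h j \<le> h i" by blast
  have attains: "\<exists>j<n. h j = Suc t" if "i < n" "t < h i" for i t
    by (rule symmetric_canonical_attains[OF assms(2)[unfolded \<xi>] anti that])
  have "card {i. i < n \<and> odd (h i)} = m"
    using assms(3,4) unfolding \<xi> by (intro card_odd_of_orbit) auto
  then have flat: "h i \<le> 2 * m" if "i < n" for i
    using gap_free_le_twice_odd[OF attains that] by simp
  have stairs: "h i \<le> n - i" if "i < n" for i
    by (rule gap_free_le_index[OF anti attains that])
  have r: "r_number n d \<rho> \<xi> = 2 * (\<Sum>i<k. real (h i))" if "is_fund_rep n k d \<rho>" "k \<le> n" for k d \<rho>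
    unfolding \<xi> by (rule r_number_fund_rep[OF that])
  have low: "r_number n d \<rho> \<xi> \<le> 4 * real m * real k" if "is_fund_rep n k d \<rho>" "k \<le> n" for k d \<rho>
    unfolding r[OF that] using flat stairs assms(4) refl that(2) by (rule twice_sum_staircase_le(1))
  have high: "r_number n d \<rho> \<xi> \<le> 4 * real m * (real n - 2 * real m + 1)
      + (real k - real n + 2 * real m - 1) * (2 * real m + real n - real k)"
    if "is_fund_rep n k d \<rho>" "k \<le> n" "n - 2 * m + 1 < k" for k d \<rho>
  proof -
    have p: "real (n - 2 * m + 1) = real n - 2 * real m + 1" using assms(4) by (simp add: of_nat_diff)
    have "2 * (\<Sum>i<k. real (h i)) \<le> 4 * real m * real (n - 2 * m + 1)
        + (real k - real (n - 2 * m + 1)) * (2 * real m + real n - real k)"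
      by (rule twice_sum_staircase_le(2)[OF flat stairs assms(4) refl that(2)]) (use that(3) in auto)
    then show ?thesis unfolding r[OF that(1,2)] p by (simp add: algebra_simps)
  qed
  show ?thesis
  proof (intro conjI allI impI; (elim conjE)?)
    fix d \<rho> assume "is_fund_rep n 1 d \<rho>"
    from low[OF this assms(1)] show "r_number n d \<rho> \<xi> \<le> 4 * real m" by simp
  next
    fix d \<rho> assume "n \<ge> 2" "is_fund_rep n 2 d \<rho>"
    from low[OF this(2,1)] show "r_number n d \<rho> \<xi> \<le> 8 * real m" by simp
  next
    fix d \<rho> assume "n \<ge> 2" "is_fund_rep n 2 d \<rho>" and half: "2 * m = n"
    from high[OF this(2,1)] show "r_number n d \<rho> \<xi> \<le> 8 * real m - 2"
      by (simp add: algebra_simps flip: half)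
  qed (use low high in auto)
qed

end
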